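(* Let $G = G_2(\alpha,\beta,0,\delta,-)$ be a metacyclic $2$-group of negative type with $\epsilon=0$ and $\beta\ge 3$, with generators $x,y$ as in its presentation, and let $M=\langle x,y^2\rangle$. (1) If $\delta=1$, then $\eta(G)=\eta(M)/2+2=g_2(\alpha,\beta-1)/2+2$. (2) If $\delta=0$, then $\eta(G)=\eta(M)/2+3=g_2(\alpha,\beta-1)/2+3$.
   Context: For a finite group $G$, a maximal cyclic subgroup is a cyclic subgroup not properly contained in any other cyclic subgroup, and $\eta(G)$ is the number of conjugacy classes of maximal cyclic subgroups of $G$. Write $x^y = y^{-1}xy$. For integers $\alpha,\beta>0$, $\delta\ge 0$, $\epsilon\in\{0,1\}$ with $\delta\le\beta$, $\alpha-\delta\ge 2$ and $\delta+\epsilon\le\alpha$ (and $\beta\ge\delta+1$ when $\epsilon=1$), the metacyclic $2$-group of negative type is $$G_2(\alpha,\beta,\epsilon,\delta,-)=\langle x,y \mid x^{2^\alpha}=1,\ y^{2^\beta}=x^{2^{\alpha-\epsilon}},\ x^y=x^{r}\rangle,\quad r=2^{\alpha-\delta}-1.$$ It has order $2^{\alpha+\beta}$. For positive integers $a,b$, with $k=\max(a,b)$ and $l=\min(a,b)$, set $g_2(a,b)=2^{l-1}(k-l+3)$. *)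

theory Defs
  imports "HOL-Algebra.Algebra"
begin

section \<open>Groups given by generators and relations\<close>

text \<open>
  A word is a list of letters; the letter \<open>(g, False)\<close> stands for the generator \<open>g\<close> and
  \<open>(g, True)\<close> for its formal inverse.  A presentation is a set of pairs of words, the pair
  \<open>(u, v)\<close> being the relation \<open>u = v\<close>.  The presented group is the quotient of the monoid of words
  by the least congruence that cancels \<open>g g\<inverse>\<close> and \<open>g\<inverse> g\<close> and contains the relations, i.e. the
  quotient of the free group by the normal closure of the relators \<open>u v\<inverse>\<close>.
\<close>

type_synonym 'g word = "('g \<times> bool) list"

inductive word_eq :: "('g word \<times> 'g word) set \<Rightarrow> 'g word \<Rightarrow> 'g word \<Rightarrow> bool"
  for R :: "('g word \<times> 'g word) set" where
  refl: "word_eq R u u"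
| sym: "word_eq R u v \<Longrightarrow> word_eq R v u"
| trans: "word_eq R u v \<Longrightarrow> word_eq R v w \<Longrightarrow> word_eq R u w"
| append: "word_eq R u u' \<Longrightarrow> word_eq R v v' \<Longrightarrow> word_eq R (u @ v) (u' @ v')"
| cancel: "word_eq R [(g, b), (g, \<not> b)] []"
| relation: "(u, v) \<in> R \<Longrightarrow> word_eq R u v"

definition word_class :: "('g word \<times> 'g word) set \<Rightarrow> 'g word \<Rightarrow> 'g word set" where
  "word_class R u = {v. word_eq R u v}"

definition presented_group :: "('g word \<times> 'g word) set \<Rightarrow> 'g word set monoid" where
  "presented_group R =
     \<lparr>carrier = range (word_class R),
      monoid.mult = (\<lambda>A B. \<Union>u\<in>A. \<Union>v\<in>B. word_class R (u @ v)),
      monoid.one = word_class R []\<rparr>"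

definition presented_gen :: "('g word \<times> 'g word) set \<Rightarrow> 'g \<Rightarrow> 'g word set" where
  "presented_gen R g = word_class R [(g, False)]"

definition word_pow :: "'g word \<Rightarrow> nat \<Rightarrow> 'g word" where
  "word_pow w n = concat (replicate n w)"

lemma word_class_eq_iff: "word_class R u = word_class R v \<longleftrightarrow> word_eq R u v"
  unfolding word_class_def by (auto intro: word_eq.intros)

lemma presented_group_mult:
  "word_class R u \<otimes>\<^bsub>presented_group R\<^esub> word_class R v = word_class R (u @ v)"
  unfolding presented_group_def word_class_def
  by (auto intro: word_eq.intros)

lemma word_left_inverse: "\<exists>v. word_eq R (v @ u) []"
proof (induction u)
  case Nil
  show ?case by (auto intro: word_eq.refl exI[of _ "[]"])
next
  case (Cons a u)
  obtain g b where a: "a = (g, b)" by (cases a)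
  obtain v where v: "word_eq R (v @ u) []" using Cons.IH by blast
  have "word_eq R ([(g, \<not> b), (g, b)]) []"
    using word_eq.cancel[of R g "\<not> b"] by simp
  then have "word_eq R (v @ ([(g, \<not> b), (g, b)] @ u)) (v @ ([] @ u))"
    by (intro word_eq.append word_eq.refl)
  then have "word_eq R ((v @ [(g, \<not> b)]) @ (a # u)) []"
    using v by (auto simp: a intro: word_eq.trans)
  then show ?case by blast
qed

lemma group_presented_group: "group (presented_group R)"
proof (rule groupI)
  fix A B C
  assume "A \<in> carrier (presented_group R)" "B \<in> carrier (presented_group R)"
    "C \<in> carrier (presented_group R)"
  then obtain u v w where "A = word_class R u" "B = word_class R v" "C = word_class R w"
    by (auto simp: presented_group_def)
  then show "A \<otimes>\<^bsub>presented_group R\<^esub> B \<otimes>\<^bsub>presented_group R\<^esub> C =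
      A \<otimes>\<^bsub>presented_group R\<^esub> (B \<otimes>\<^bsub>presented_group R\<^esub> C)"
    by (simp add: presented_group_mult)
next
  fix A B
  assume "A \<in> carrier (presented_group R)" "B \<in> carrier (presented_group R)"
  then obtain u v where "A = word_class R u" "B = word_class R v"
    by (auto simp: presented_group_def)
  then show "A \<otimes>\<^bsub>presented_group R\<^esub> B \<in> carrier (presented_group R)"
    unfolding presented_group_mult by (simp add: presented_group_mult) (simp add: presented_group_def)
next
  show "\<one>\<^bsub>presented_group R\<^esub> \<in> carrier (presented_group R)"
    by (simp add: presented_group_def)
next
  fix A
  assume "A \<in> carrier (presented_group R)"
  then obtain u where A: "A = word_class R u"
    by (auto simp: presented_group_def)
  have one: "\<one>\<^bsub>presented_group R\<^esub> = word_class R []"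
    by (simp add: presented_group_def)
  show "\<one>\<^bsub>presented_group R\<^esub> \<otimes>\<^bsub>presented_group R\<^esub> A = A"
    by (simp add: A one presented_group_mult)
  obtain v where "word_eq R (v @ u) []" using word_left_inverse by blast
  then have "word_class R v \<otimes>\<^bsub>presented_group R\<^esub> A = \<one>\<^bsub>presented_group R\<^esub>"
    by (simp add: A one presented_group_mult word_class_eq_iff)
  then show "\<exists>B\<in>carrier (presented_group R). B \<otimes>\<^bsub>presented_group R\<^esub> A = \<one>\<^bsub>presented_group R\<^esub>"
    by (auto simp: presented_group_def)
qed


section \<open>Conjugacy classes of maximal cyclic subgroups\<close>

definition cyclic_subgroup :: "'a set \<Rightarrow> ('a, 'b) monoid_scheme \<Rightarrow> bool" where
  "cyclic_subgroup C G \<longleftrightarrow> subgroup C G \<and> cyclic_group (G\<lparr>carrier := C\<rparr>)"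

definition maximal_cyclic_subgroup :: "'a set \<Rightarrow> ('a, 'b) monoid_scheme \<Rightarrow> bool" where
  "maximal_cyclic_subgroup C G \<longleftrightarrow>
     cyclic_subgroup C G \<and> \<not> (\<exists>D. cyclic_subgroup D G \<and> C \<subset> D)"

text \<open>
  The conjugates of \<open>H\<close> are the sets \<open>g H g\<inverse>\<close>; as \<open>g\<close> runs through the whole group these are also
  the sets \<open>g\<inverse> H g\<close>.
\<close>

definition eta :: "('a, 'b) monoid_scheme \<Rightarrow> nat" where
  "eta G = card (orbits G {C. maximal_cyclic_subgroup C G}
                   (\<lambda>g H. g <#\<^bsub>G\<^esub> H #>\<^bsub>G\<^esub> inv\<^bsub>G\<^esub> g))"


section \<open>Metacyclic 2-groups of negative type\<close>

definition G2_neg_params :: "nat \<Rightarrow> nat \<Rightarrow> nat \<Rightarrow> nat \<Rightarrow> bool" where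
  "G2_neg_params \<alpha> \<beta> \<epsilon> \<delta> \<longleftrightarrow>
     \<alpha> > 0 \<and> \<beta> > 0 \<and> \<epsilon> \<in> {0, 1} \<and> \<delta> \<le> \<beta> \<and> \<delta> + 2 \<le> \<alpha> \<and> \<delta> + \<epsilon> \<le> \<alpha> \<and>
     (\<epsilon> = 1 \<longrightarrow> \<delta> + 1 \<le> \<beta>)"

datatype metacyclic_gen = Gen_x | Gen_y

abbreviation letter_x :: "metacyclic_gen word" where "letter_x \<equiv> [(Gen_x, False)]"
abbreviation letter_y :: "metacyclic_gen word" where "letter_y \<equiv> [(Gen_y, False)]"
abbreviation letter_y_inv :: "metacyclic_gen word" where "letter_y_inv \<equiv> [(Gen_y, True)]"

definition G2_neg_relations ::
    "nat \<Rightarrow> nat \<Rightarrow> nat \<Rightarrow> nat \<Rightarrow> (metacyclic_gen word \<times> metacyclic_gen word) set" where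
  "G2_neg_relations \<alpha> \<beta> \<epsilon> \<delta> =
     {(word_pow letter_x (2 ^ \<alpha>), []),
      (word_pow letter_y (2 ^ \<beta>), word_pow letter_x (2 ^ (\<alpha> - \<epsilon>))),
      (letter_y_inv @ letter_x @ letter_y, word_pow letter_x (2 ^ (\<alpha> - \<delta>) - 1))}"

definition G2_neg :: "nat \<Rightarrow> nat \<Rightarrow> nat \<Rightarrow> nat \<Rightarrow> metacyclic_gen word set monoid" where
  "G2_neg \<alpha> \<beta> \<epsilon> \<delta> = presented_group (G2_neg_relations \<alpha> \<beta> \<epsilon> \<delta>)"

definition G2_neg_x :: "nat \<Rightarrow> nat \<Rightarrow> nat \<Rightarrow> nat \<Rightarrow> metacyclic_gen word set" where
  "G2_neg_x \<alpha> \<beta> \<epsilon> \<delta> = presented_gen (G2_neg_relations \<alpha> \<beta> \<epsilon> \<delta>) Gen_x"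

definition G2_neg_y :: "nat \<Rightarrow> nat \<Rightarrow> nat \<Rightarrow> nat \<Rightarrow> metacyclic_gen word set" where
  "G2_neg_y \<alpha> \<beta> \<epsilon> \<delta> = presented_gen (G2_neg_relations \<alpha> \<beta> \<epsilon> \<delta>) Gen_y"

text \<open>Meant for positive arguments, where none of the subtractions truncates.\<close>

definition g2 :: "nat \<Rightarrow> nat \<Rightarrow> nat" where
  "g2 a b = (let k = max a b; l = min a b in 2 ^ (l - 1) * (k - l + 3))"

end

theory Submission
  imports Defs "HOL-Number_Theory.Cong"
begin

text \<open>
  Every element of \<open>G\<close> is \<open>x\<^sup>i y\<^sup>j\<close> with \<open>i\<close> unique modulo \<open>2\<^sup>\<alpha>\<close> and \<open>j\<close> unique modulo
  \<open>2\<^sup>\<beta>\<close>.  Since \<open>\<delta> \<le> 1\<close>, the multiplier \<open>r\<close> satisfies \<open>r\<^sup>2 = 1\<close> modulo \<open>2\<^sup>\<alpha>\<close>, so \<open>y\<^sup>2\<close> is central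
  and \<open>M\<close>, of index two, is the product of the cyclic groups generated by \<open>x\<close> and \<open>y\<^sup>2\<close>,
  of orders \<open>2\<^sup>\<alpha>\<close> and \<open>2\<^sup>b\<close> with \<open>b = \<beta> - 1\<close>.

  The group \<open>M\<close>.  A cyclic subgroup of \<open>M\<close> is maximal exactly when it is generated by an element
  with an odd coordinate.  Scaling an odd coordinate to 1 leaves the generators \<open>(1, j)\<close> and
  \<open>(2i, 1)\<close>, and two generators of the same kind give the same subgroup exactly when they differ
  by a multiplier congruent to 1 modulo \<open>2\<^sup>\<alpha>\<close>, respectively \<open>2\<^sup>b\<close>.  Counting these orbits of
  residues gives \<open>g2 \<alpha> b\<close> (\<open>dilation_classes_sum_eq_g2\<close>), and \<open>M\<close> is abelian, so this is
  \<open>eta M\<close> (\<open>eta_eq_g2\<close>).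

  The group \<open>G\<close>.  Every cyclic subgroup that leaves \<open>M\<close> is generated by some \<open>x\<^sup>i y\<close>, and all of these
  are maximal.  They form two conjugacy classes, separated by the parity of \<open>i\<close>.  Because
  \<open>(x\<^sup>i y)\<^sup>2 = x\<^bsup>(1 + r) i\<^esup> y\<^sup>2\<close>, a maximal cyclic subgroup of \<open>M\<close> remains maximal in \<open>G\<close> unless it is one
  of the groups generated by \<open>x\<^bsup>(1 + r) i\<^esup> y\<^sup>2\<close> (\<open>maximal_cyclic_subgroups_G\<close>).  As \<open>1 + r = 2\<^bsup>\<alpha> - \<delta>\<^esup>\<close>,
  the number \<open>c\<close> of these exceptions is 1 for \<open>\<delta> = 0\<close> and 2 for \<open>\<delta> = 1\<close>.

  On the subgroups of \<open>M\<close>, conjugation by \<open>G\<close> acts through the involution induced by \<open>y\<close>.  It fixes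
  exactly four maximal cyclic subgroups of \<open>M\<close> (\<open>normal_maximal_iff\<close>), and the exceptions are
  among them.  So the remaining \<open>eta M - c\<close> subgroups, \<open>4 - c\<close> of them fixed, form
  \<open>(eta M + 4 - 2 c) / 2\<close> conjugacy classes, and \<open>eta G = eta M / 2 + 4 - c\<close> (\<open>twice_eta_eq\<close>).

  That the coordinates \<open>i\<close> and \<open>j\<close> are unique needs an argument, since a presentation by itself
  only bounds a group from above: words act on pairs of integers as right multiplication acts on
  coordinates, and modulo \<open>2\<^sup>\<alpha>\<close> and \<open>2\<^sup>\<beta>\<close> this action respects the relations
  (\<open>word_eq_imp_cong_action\<close>).
\<close>

section \<open>Counting images and inverting odd numbers\<close>

text \<open>
  Families of subgroups are counted by exchanging a subgroup for an arithmetic invariant of a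
  generator that has the same fibres.
\<close>

lemma card_image_eq_if_same_kernel:
  assumes "\<And>s t. s \<in> S \<Longrightarrow> t \<in> S \<Longrightarrow> f s = f t \<longleftrightarrow> g s = g t"
  shows "card (f ` S) = card (g ` S)" and "finite (f ` S) \<longleftrightarrow> finite (g ` S)"
proof -
  \<comment> \<open>The induced map from values of \<open>f\<close> to values of \<open>g\<close>.\<close>
  define \<phi> where "\<phi> v = g (SOME s. s \<in> S \<and> f s = v)" for v
  have \<phi>: "\<phi> (f s) = g s" if "s \<in> S" for s
  proof -
    have "\<exists>t. t \<in> S \<and> f t = f s" using that by blast
    then have "(SOME t. t \<in> S \<and> f t = f s) \<in> S \<and> f (SOME t. t \<in> S \<and> f t = f s) = f s"
      by (rule someI_ex)
    then show ?thesis using assms that unfolding \<phi>_def by blast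
  qed
  have "\<phi> ` f ` S = g ` S" using \<phi> by (auto simp: image_iff)
  moreover have "inj_on \<phi> (f ` S)" using \<phi> assms by (auto intro!: inj_onI)
  ultimately have "bij_betw \<phi> (f ` S) (g ` S)" by (simp add: bij_betw_def)
  then show "card (f ` S) = card (g ` S)" "finite (f ` S) \<longleftrightarrow> finite (g ` S)"
    by (rule bij_betw_same_card, rule bij_betw_finite)
qed

lemma odd_inverse_mod_power_2:
  fixes u :: int
  assumes "odd u"
  obtains s where "[u * s = 1] (mod 2 ^ n)"
proof -
  have "coprime u (2 ^ n)" using assms by simp
  then show ?thesis using that cong_solve_coprime_int by blast
qed

lemma odd_if_cong_odd:
  fixes i k :: int
  assumes "[i = k] (mod 2 ^ n)" "n > 0"
  shows "odd i \<longleftrightarrow> odd k"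
proof -
  have "[i = k] (mod 2)" using assms by (meson cong_dvd_modulus dvd_power)
  then show ?thesis by (metis cong_dvd_iff)
qed

text \<open>
  A fixed point is an orbit by itself, and every other orbit has two elements.
\<close>

lemma card_involution_orbits:
  assumes fin: "finite S" and maps: "\<And>x. x \<in> S \<Longrightarrow> s x \<in> S" and inv: "\<And>x. x \<in> S \<Longrightarrow> s (s x) = x"
  shows "2 * card ((\<lambda>x. {x, s x}) ` S) = card S + card {x \<in> S. s x = x}"
proof -
  let ?o = "\<lambda>x. {x, s x}"
  define F where "F = {x \<in> S. s x = x}"
  define N where "N = {x \<in> S. s x \<noteq> x}"
  have S: "S = F \<union> N" "F \<inter> N = {}" "finite F" "finite N" using fin by (auto simp: F_def N_def)
  have "?o ` F = (\<lambda>x. {x}) ` F" by (auto simp: F_def)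
  then have cF: "card (?o ` F) = card F" by (simp add: card_image)
  have "2 * card (?o ` N) = card (\<Union>(?o ` N))"
  proof (rule card_partition)
    show "finite (?o ` N)" "finite (\<Union>(?o ` N))" using S by auto
    show "card c = 2" if "c \<in> ?o ` N" for c using that by (auto simp: N_def)
    show "c1 \<inter> c2 = {}" if c: "c1 \<in> ?o ` N" "c2 \<in> ?o ` N" "c1 \<noteq> c2" for c1 c2
    proof -
      obtain x where x: "x \<in> S" "c1 = ?o x" using c(1) unfolding N_def by blast
      obtain y where y: "y \<in> S" "c2 = ?o y" using c(2) unfolding N_def by blast
      have "c1 = c2" if "z \<in> c1" "z \<in> c2" for z
        using that x y inv[OF x(1)] inv[OF y(1)] by (metis insertE insert_commute singletonD)
      then show ?thesis using c(3) by blast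
    qed
  qed
  moreover have "\<Union>(?o ` N) = N" using maps inv by (auto simp: N_def)
  ultimately have cN: "2 * card (?o ` N) = card N" by simp
  have "?o ` F \<inter> ?o ` N = {}" by (auto simp: F_def N_def doubleton_eq_iff)
  then have "card (?o ` S) = card (?o ` F) + card (?o ` N)"
    using S by (simp add: image_Un card_Un_disjoint)
  moreover have "card S = card F + card N" using S card_Un_disjoint by metis
  ultimately show ?thesis using cF cN by (simp add: F_def)
qed

lemma cong_half_modulus_cases:
  fixes v :: int
  assumes "2 ^ n dvd 2 * v" "n > 0"
  shows "[v = 0] (mod 2 ^ n) \<or> [v = 2 ^ (n - 1)] (mod 2 ^ n)"
proof -
  obtain n' where n: "n = Suc n'" using assms(2) by (cases n) auto
  then obtain w where w: "v = 2 ^ n' * w" using assms(1) by auto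
  show ?thesis
  proof (cases "even w")
    case True
    then show ?thesis using w n by (auto simp: cong_0_iff elim!: evenE)
  next
    case False
    then obtain q where "w = 2 * q + 1" by (rule oddE)
    then have "v - 2 ^ n' = 2 ^ n * q" using w n by (simp add: algebra_simps)
    then show ?thesis using n by (simp add: cong_iff_dvd_diff)
  qed
qed

text \<open>
  The factor \<open>d\<close> is twice an odd number, and the odd part is prime to the modulus.
\<close>

lemma power_2_dvd_2_mult_if_dvd_twice_odd_mult:
  fixes d v :: int
  assumes "2 ^ n dvd d * v" "[d = 2] (mod 4)"
  shows "2 ^ n dvd 2 * v"
proof -
  obtain q where q: "d = 2 + 4 * q"
    using cong_sym[OF assms(2)] by (auto simp: cong_iff_lin)
  have "d * v = (2 * v) * (1 + 2 * q)" using q by (simp add: algebra_simps)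
  moreover have "coprime (2 ^ n) (1 + 2 * q)" by simp
  ultimately show ?thesis using assms(1) coprime_dvd_mult_left_iff by metis
qed

lemma half_modulus_not_cong_0: "n > 0 \<Longrightarrow> \<not> [2 ^ (n - 1) = (0::int)] (mod 2 ^ n)"
  by (cases n) (auto simp: cong_0_iff dest: zdvd_imp_le)

lemma odd_mult_half_modulus:
  fixes t :: int
  assumes "odd t" "n > 0"
  shows "[t * 2 ^ (n - 1) = 2 ^ (n - 1)] (mod 2 ^ n)"
proof -
  obtain n' where n: "n = Suc n'" using assms(2) by (cases n) auto
  obtain q where "t = 2 * q + 1" using assms(1) by (rule oddE)
  then have "t * 2 ^ n' - 2 ^ n' = 2 ^ n * q" using n by (simp add: algebra_simps)
  then show ?thesis using n by (simp add: cong_iff_dvd_diff)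
qed

section \<open>Orbits of residues under multipliers congruent to 1\<close>

text \<open>
  The orbit of the residue \<open>i\<close> modulo \<open>2\<^sup>n\<close> under the multipliers congruent to 1 modulo \<open>2\<^sup>c\<close>,
  represented by the set of all integers in it.
\<close>

definition dilation_class :: "nat \<Rightarrow> nat \<Rightarrow> int \<Rightarrow> int set" where
  "dilation_class c n i = {i'. \<exists>t. [t = 1] (mod 2 ^ c) \<and> [i' = t * i] (mod 2 ^ n)}"

text \<open>
  A multiplier is odd, so it has an inverse modulo \<open>2\<^bsup>c + n\<^esup>\<close>.  The inverse is again congruent to 1
  modulo \<open>2\<^sup>c\<close>, so being related by a multiplier is symmetric.
\<close>

lemma dilation_class_eq_iff:
  assumes "c > 0"
  shows "dilation_class c n i = dilation_class c n i' \<longleftrightarrow>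
    (\<exists>t. [t = 1] (mod 2 ^ c) \<and> [i' = t * i] (mod 2 ^ n))"
proof
  assume "dilation_class c n i = dilation_class c n i'"
  moreover have "i' \<in> dilation_class c n i'"
    unfolding dilation_class_def by (auto intro!: exI[of _ 1])
  ultimately show "\<exists>t. [t = 1] (mod 2 ^ c) \<and> [i' = t * i] (mod 2 ^ n)"
    by (auto simp: dilation_class_def)
next
  have step: "dilation_class c n j' \<subseteq> dilation_class c n j"
    if t: "[t = 1] (mod 2 ^ c)" "[j' = t * j] (mod 2 ^ n)" for j j' t
  proof
    fix k assume "k \<in> dilation_class c n j'"
    then obtain u where u: "[u = 1] (mod 2 ^ c)" "[k = u * j'] (mod 2 ^ n)"
      by (auto simp: dilation_class_def)
    have "[u * t = 1 * 1] (mod 2 ^ c)" using u(1) t(1) by (rule cong_mult)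
    moreover have "[k = u * t * j] (mod 2 ^ n)"
      using cong_trans[OF u(2) cong_scalar_left[OF t(2), of u]] by (simp add: mult.assoc)
    ultimately show "k \<in> dilation_class c n j" by (auto simp: dilation_class_def)
  qed
  assume "\<exists>t. [t = 1] (mod 2 ^ c) \<and> [i' = t * i] (mod 2 ^ n)"
  then obtain t where t: "[t = 1] (mod 2 ^ c)" "[i' = t * i] (mod 2 ^ n)" by blast
  have "odd t" using odd_if_cong_odd[OF t(1) assms] by simp
  then obtain s where s: "[t * s = 1] (mod 2 ^ (c + n))" by (rule odd_inverse_mod_power_2)
  have sc: "[t * s = 1] (mod 2 ^ c)" and sn: "[t * s = 1] (mod 2 ^ n)"
    by (rule cong_dvd_modulus[OF s], simp add: le_imp_power_dvd)+
  have "[s = 1] (mod 2 ^ c)"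
    using cong_trans[OF cong_sym[OF cong_scalar_right[OF t(1), of s]] sc] by simp
  moreover have "[i = s * i'] (mod 2 ^ n)"
    using cong_trans[OF cong_scalar_left[OF t(2), of s], of i] cong_scalar_right[OF sn, of i]
    by (simp add: ac_simps cong_sym_eq)
  ultimately show "dilation_class c n i = dilation_class c n i'"
    using step t by blast
qed

lemma card_odd_residues:
  fixes n :: nat
  shows "card ((\<lambda>i::int. i mod 2 ^ Suc n) ` {i. odd i}) = 2 ^ n"
    and "finite ((\<lambda>i::int. i mod 2 ^ Suc n) ` {i. odd i})"
proof -
  have "(\<lambda>i::int. i mod 2 ^ Suc n) ` {i. odd i} = (\<lambda>k. 2 * k + 1) ` {0..<2 ^ n}"
  proof (intro equalityI subsetI)
    fix v assume "v \<in> (\<lambda>i::int. i mod 2 ^ Suc n) ` {i. odd i}"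
    then obtain i :: int where i: "odd i" "v = i mod 2 ^ Suc n" by blast
    then have "odd v" by (simp add: dvd_mod_iff)
    moreover have "0 \<le> v" "v < 2 * 2 ^ n" using i(2) by simp_all
    ultimately show "v \<in> (\<lambda>k. 2 * k + 1) ` {0..<2 ^ n}"
      by (intro image_eqI[of _ _ "v div 2"]) auto
  next
    fix v :: int assume "v \<in> (\<lambda>k. 2 * k + 1) ` {0..<2 ^ n}"
    then have "odd v" "0 \<le> v" "v < 2 ^ Suc n" by auto
    then show "v \<in> (\<lambda>i::int. i mod 2 ^ Suc n) ` {i. odd i}"
      by (intro image_eqI[of _ _ v]) simp_all
  qed
  moreover have "inj_on (\<lambda>k::int. 2 * k + 1) {0..<2 ^ n}" by (simp add: inj_on_def)
  ultimately show "card ((\<lambda>i::int. i mod 2 ^ Suc n) ` {i. odd i}) = 2 ^ n"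
    "finite ((\<lambda>i::int. i mod 2 ^ Suc n) ` {i. odd i})"
    by (simp_all add: card_image nat_power_eq)
qed

text \<open>
  Between odd residues the multiplier is forced to be the quotient \<open>i' / i\<close> modulo \<open>2\<^sup>n\<close>, so the only
  question is whether this quotient can be 1 modulo \<open>2\<^sup>c\<close>.
\<close>

lemma odd_dilation_class_eq_iff:
  assumes "c > 0" "odd i" "odd i'"
  shows "dilation_class c n i = dilation_class c n i' \<longleftrightarrow>
    i mod 2 ^ min c n = i' mod 2 ^ min c n"
proof -
  have "(\<exists>t. [t = 1] (mod 2 ^ c) \<and> [i' = t * i] (mod 2 ^ n)) \<longleftrightarrow> [i = i'] (mod 2 ^ min c n)"
  proof
    assume "\<exists>t. [t = 1] (mod 2 ^ c) \<and> [i' = t * i] (mod 2 ^ n)"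
    then obtain t where t: "[t = 1] (mod 2 ^ c)" "[i' = t * i] (mod 2 ^ n)" by blast
    have "[t = 1] (mod 2 ^ min c n)" "[i' = t * i] (mod 2 ^ min c n)"
      by (rule cong_dvd_modulus[OF t(1)] cong_dvd_modulus[OF t(2)], simp add: le_imp_power_dvd)+
    then show "[i = i'] (mod 2 ^ min c n)"
      by (metis cong_scalar_right cong_sym cong_trans mult_1)
  next
    assume L: "[i = i'] (mod 2 ^ min c n)"
    show "\<exists>t. [t = 1] (mod 2 ^ c) \<and> [i' = t * i] (mod 2 ^ n)"
    proof (cases "c \<le> n")
      case True
      \<comment> \<open>The multiplier is \<open>i' s\<close>, that is, \<open>i'\<close> divided by \<open>i\<close>.\<close>
      obtain s where s: "[i * s = 1] (mod 2 ^ n)"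
        using odd_inverse_mod_power_2[OF assms(2)] .
      have sc: "[i * s = 1] (mod 2 ^ c)"
        by (rule cong_dvd_modulus[OF s]) (simp add: True le_imp_power_dvd)
      have "[i' * s = 1] (mod 2 ^ c)"
        using L True cong_trans[OF cong_scalar_right[of i' i _ s] sc] by (simp add: cong_sym_eq)
      moreover have "[i' = i' * s * i] (mod 2 ^ n)"
        using cong_scalar_left[OF s, of i'] by (simp add: ac_simps cong_sym_eq)
      ultimately show ?thesis by blast
    next
      case False
      then show ?thesis using L by (intro exI[of _ 1]) (simp add: cong_sym_eq)
    qed
  qed
  then show ?thesis using dilation_class_eq_iff[OF assms(1)] by (simp add: cong_def)
qed

lemma even_dilation_class_eq_iff:
  assumes "c > 0"
  shows "dilation_class c (Suc n) (2 * i) = dilation_class c (Suc n) (2 * i') \<longleftrightarrow>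
    dilation_class c n i = dilation_class c n i'"
proof -
  have "[2 * i' = t * (2 * i)] (mod 2 ^ Suc n) \<longleftrightarrow> [i' = t * i] (mod 2 ^ n)" for t
  proof -
    have factor_2: "2 * i' - t * (2 * i) = 2 * (i' - t * i)" by (simp add: algebra_simps)
    show ?thesis unfolding cong_iff_dvd_diff factor_2 power_Suc dvd_mult_cancel_left by simp
  qed
  then show ?thesis by (simp add: dilation_class_eq_iff[OF assms])
qed

text \<open>
  Recursion on the modulus: the orbits of even residues modulo \<open>2\<^bsup>n + 1\<^esup>\<close> are the doubles of the
  orbits modulo \<open>2\<^sup>n\<close>, and the orbits of odd residues are the odd residues modulo the smaller of
  \<open>2\<^sup>c\<close> and \<open>2\<^bsup>n + 1\<^esup>\<close>.
\<close>

lemma finite_card_dilation_classes: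
  assumes "c > 0"
  shows "finite (range (dilation_class c n)) \<and>
    card (range (dilation_class c n)) = 1 + (\<Sum>t<n. 2 ^ (min c (Suc t) - 1))"
proof (induction n)
  case 0
  have "range (dilation_class c 0) = {UNIV}"
    by (auto simp: dilation_class_def intro: exI[of _ 1])
  then show ?case by simp
next
  case (Suc n)
  let ?D = "dilation_class c (Suc n)"
  have even: "range (\<lambda>i. ?D (2 * i)) = ?D ` {i. even i}" by (auto simp: image_iff elim!: evenE)
  have E: "card (?D ` {i. even i}) = card (range (dilation_class c n))"
    "finite (?D ` {i. even i})"
    using card_image_eq_if_same_kernel[of UNIV "\<lambda>i. ?D (2 * i)" "dilation_class c n",
        OF even_dilation_class_eq_iff[OF assms]] Suc[THEN conjunct1] unfolding even by blast+
  obtain d where d: "min c (Suc n) = Suc d" using assms by (cases c) auto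
  have O_iff: "?D i = ?D i' \<longleftrightarrow> i mod 2 ^ Suc d = i' mod 2 ^ Suc d"
    if "i \<in> {i. odd i}" "i' \<in> {i. odd i}" for i i'
    using odd_dilation_class_eq_iff[OF assms, of i i' "Suc n"] that unfolding d by blast
  have O: "card (?D ` {i. odd i}) = 2 ^ d" "finite (?D ` {i. odd i})"
    using card_image_eq_if_same_kernel[where S = "{i. odd i}" and f = ?D, OF O_iff]
      card_odd_residues[of d] by (simp_all del: power_Suc)
  have "?D ` {i. even i} \<inter> ?D ` {i. odd i} = {}"
  proof -
    have False if par: "even i" "odd i'" and eq: "?D i = ?D i'" for i i'
    proof -
      obtain t where "[i' = t * i] (mod 2 ^ Suc n)"
        using dilation_class_eq_iff[OF assms, THEN iffD1, OF eq] by blast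
      then show False using odd_if_cong_odd[of i' "t * i" "Suc n"] par by simp
    qed
    then show ?thesis by blast
  qed
  then have "card (?D ` {i. even i} \<union> ?D ` {i. odd i}) = card (range (dilation_class c n)) + 2 ^ d"
    using card_Un_disjoint[OF E(2) O(2)] unfolding E(1) O(1) by blast
  moreover have "finite (?D ` {i. even i} \<union> ?D ` {i. odd i})" using E(2) O(2) by (rule finite_UnI)
  moreover have "range ?D = ?D ` {i. even i} \<union> ?D ` {i. odd i}" by blast
  ultimately have "card (range ?D) = card (range (dilation_class c n)) + 2 ^ d"
    "finite (range ?D)" by (simp_all only:)
  then show ?case unfolding Suc[THEN conjunct2] sum.lessThan_Suc d by simp
qed

lemma card_dilation_classes_small:
  assumes "c > 0" "n \<le> c"
  shows "card (range (dilation_class c n)) = 2 ^ n"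
proof -
  have "1 + (\<Sum>t<n. 2 ^ (min c (Suc t) - 1)) = (2::nat) ^ n"
    using assms(2) by (induction n) simp_all
  then show ?thesis using finite_card_dilation_classes[OF assms(1)] by simp
qed

lemma card_dilation_classes_large:
  assumes "c > 0"
  shows "card (range (dilation_class c (c + d))) = 2 ^ c + d * 2 ^ (c - 1)"
proof (induction d)
  case 0
  then show ?case using card_dilation_classes_small[OF assms] by simp
next
  case (Suc d)
  then show ?case using finite_card_dilation_classes[OF assms] by simp
qed

text \<open>
  Whichever of \<open>a\<close> and \<open>b\<close> is larger, the multipliers act trivially in one of the two counts, which
  is then a power of 2.  The other count has the linear factor of \<open>g2\<close>.
\<close>

lemma dilation_classes_sum_eq_g2:
  assumes "a > 0" "b > 0"
  shows "card (range (dilation_class a b)) + card (range (dilation_class b (a - 1))) = g2 a b"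
proof (cases "b < a")
  case True
  then obtain d where d: "a - 1 = b + d" by (metis Suc_diff_1 assms(1) less_Suc_eq_le nat_le_iff_add)
  obtain b' where b': "b = Suc b'" using assms(2) by (cases b) auto
  have "a = Suc (b + d)" using True d by simp
  then show ?thesis using card_dilation_classes_small[of a b] card_dilation_classes_large[of b d] assms b'
    by (simp add: g2_def Let_def algebra_simps)
next
  case False
  then obtain d where d: "b = a + d" by (metis le_Suc_ex not_le)
  obtain a' where a': "a = Suc a'" using assms(1) by (cases a) auto
  show ?thesis using card_dilation_classes_small[of b "a - 1"] card_dilation_classes_large[of a d] assms d a'
    by (simp add: g2_def Let_def algebra_simps)
qed

section \<open>Cyclic subgroups and their conjugates\<close>

definition powers :: "('a, 'b) monoid_scheme \<Rightarrow> 'a \<Rightarrow> 'a set" where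
  "powers G g = range (\<lambda>k::int. g [^]\<^bsub>G\<^esub> k)"

definition conjugate :: "('a, 'b) monoid_scheme \<Rightarrow> 'a \<Rightarrow> 'a set \<Rightarrow> 'a set" where
  "conjugate G u H = u <#\<^bsub>G\<^esub> H #>\<^bsub>G\<^esub> inv\<^bsub>G\<^esub> u"

context group
begin

lemma cyclic_subgroup_iff: "cyclic_subgroup C G \<longleftrightarrow> (\<exists>g\<in>carrier G. C = powers G g)"
proof
  assume "cyclic_subgroup C G"
  then have sub: "subgroup C G" and cyc: "cyclic_group (G\<lparr>carrier := C\<rparr>)"
    by (simp_all add: cyclic_subgroup_def)
  interpret C: group "G\<lparr>carrier := C\<rparr>" using sub by (rule subgroup_imp_group)
  obtain g where g: "g \<in> C" "C = range (\<lambda>n::int. g [^]\<^bsub>G\<lparr>carrier := C\<rparr>\<^esub> n)"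
    using cyc C.cyclic_group by auto
  then have "C = powers G g" unfolding powers_def using int_pow_consistent[OF sub g(1)] by simp
  then show "\<exists>g\<in>carrier G. C = powers G g" using g(1) subgroup.mem_carrier[OF sub] by blast
next
  assume "\<exists>g\<in>carrier G. C = powers G g"
  then obtain g where g: "g \<in> carrier G" "C = powers G g" by blast
  then have C: "C = generate G {g}" by (auto simp: powers_def generate_pow)
  have sub: "subgroup C G" unfolding C using g(1) by (intro generate_is_subgroup) simp
  have gC: "g \<in> C" unfolding C by (simp add: generate.incl)
  interpret C: group "G\<lparr>carrier := C\<rparr>" using sub by (rule subgroup_imp_group)
  have "C = range (\<lambda>n::int. g [^]\<^bsub>G\<lparr>carrier := C\<rparr>\<^esub> n)"
    using g(2) int_pow_consistent[OF sub gC] by (simp add: powers_def)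
  then show "cyclic_subgroup C G" using sub gC C.cyclic_group by (auto simp: cyclic_subgroup_def)
qed

lemma powers_subset_carrier: "g \<in> carrier G \<Longrightarrow> powers G g \<subseteq> carrier G"
  by (auto simp: powers_def)

lemma self_in_powers: "g \<in> carrier G \<Longrightarrow> g \<in> powers G g"
  unfolding powers_def by (rule range_eqI[of _ _ 1]) simp

lemma powers_subset_iff:
  "g \<in> carrier G \<Longrightarrow> h \<in> carrier G \<Longrightarrow> powers G g \<subseteq> powers G h \<longleftrightarrow> g \<in> powers G h"
  using self_in_powers by (auto simp: powers_def int_pow_pow)

text \<open>
  The exponent \<open>n\<close> is invertible modulo \<open>2\<^sup>K\<close>, so \<open>g\<close> is itself a power of \<open>g\<^sup>n\<close>.
\<close>

lemma powers_odd_pow: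
  fixes n :: int and K :: nat
  assumes g: "g \<in> carrier G" and K: "g [^] ((2::int) ^ K) = \<one>" and n: "odd n"
  shows "powers G (g [^] n) = powers G g"
proof -
  obtain s where s: "[n * s = 1] (mod 2 ^ K)" using odd_inverse_mod_power_2[OF n] .
  then obtain t where t: "n * s = 1 + 2 ^ K * t"
    using cong_sym[OF s] by (auto simp: cong_iff_lin)
  have "(g [^] n) [^] s = g [^] (1 + 2 ^ K * t)" using g t by (simp add: int_pow_pow)
  also have "\<dots> = g \<otimes> (g [^] ((2::int) ^ K)) [^] t"
    using g by (simp add: int_pow_mult int_pow_pow)
  also have "\<dots> = g" using g K by simp
  finally have "g \<in> powers G (g [^] n)" unfolding powers_def by (metis rangeI)
  then show ?thesis using g powers_subset_iff[of g "g [^] n"] powers_subset_iff[of "g [^] n" g]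
    by (auto simp: powers_def)
qed

lemma maximal_cyclic_subgroup_iff:
  "maximal_cyclic_subgroup C G \<longleftrightarrow>
    (\<exists>g\<in>carrier G. C = powers G g) \<and> (\<forall>h\<in>carrier G. C \<subseteq> powers G h \<longrightarrow> C = powers G h)"
  unfolding maximal_cyclic_subgroup_def cyclic_subgroup_iff by blast

lemma conjugate_eq_image:
  assumes "u \<in> carrier G" "H \<subseteq> carrier G"
  shows "conjugate G u H = (\<lambda>h. u \<otimes> h \<otimes> inv u) ` H"
  by (auto simp: conjugate_def l_coset_def r_coset_def)

lemma conjugation_pow:
  assumes "u \<in> carrier G" "g \<in> carrier G"
  shows "u \<otimes> g [^] (k::int) \<otimes> inv u = (u \<otimes> g \<otimes> inv u) [^] k"
proof -
  have "(\<lambda>h. u \<otimes> h \<otimes> inv u) \<in> hom G G"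
    using assms by (auto intro!: homI simp: m_assoc inv_solve_left)
  then show ?thesis using assms by (intro hom_int_pow is_group)
qed

lemma conjugate_powers:
  assumes "u \<in> carrier G" "g \<in> carrier G"
  shows "conjugate G u (powers G g) = powers G (u \<otimes> g \<otimes> inv u)"
  using conjugate_eq_image[OF assms(1) powers_subset_carrier[OF assms(2)]] conjugation_pow[OF assms]
  by (simp add: powers_def image_image)

lemma eta_eq: "eta G = card ((\<lambda>C. (\<lambda>u. conjugate G u C) ` carrier G) ` {C. maximal_cyclic_subgroup C G})"
proof -
  have "orbits G E (\<lambda>g H. g <# H #> inv g) = (\<lambda>C. (\<lambda>u. conjugate G u C) ` carrier G) ` E" for E
    by (auto simp: orbits_def orbit_def conjugate_def image_def)
  then show ?thesis by (simp add: eta_def)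
qed

end

section \<open>Abelian 2-groups of rank two\<close>

text \<open>
  The direct product of cyclic groups of orders \<open>2\<^sup>a\<close> and \<open>2\<^sup>b\<close>, described by a homomorphism from pairs
  of integers.  With integer coordinates no residues have to be chosen, and the parity of each
  coordinate is still well defined.
\<close>

locale rank_two_abelian_2_group = group A for A (structure) +
  fixes m :: "int \<Rightarrow> int \<Rightarrow> 'a" and a b :: nat
  assumes carrier_eq: "carrier A = (\<Union>i. range (m i))"
    and mult_eq: "m i j \<otimes> m k l = m (i + k) (j + l)"
    and eq_iff: "m i j = m k l \<longleftrightarrow> [i = k] (mod 2 ^ a) \<and> [j = l] (mod 2 ^ b)"
    and a_pos: "a > 0" and b_pos: "b > 0"
begin

abbreviation "C i j \<equiv> powers A (m i j)"

lemma m_closed [simp]: "m i j \<in> carrier A"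
  using carrier_eq by blast

lemma one_eq: "\<one> = m 0 0"
proof -
  have "m 0 0 \<otimes> m 0 0 = m 0 0" by (simp add: mult_eq)
  then show ?thesis by (simp add: l_cancel_one)
qed

lemma inv_eq: "inv (m i j) = m (- i) (- j)"
  by (rule inv_equality) (simp_all add: mult_eq one_eq)

lemma pow_eq: "m i j [^] (k::int) = m (k * i) (k * j)"
proof -
  have nat: "m i j [^] n = m (int n * i) (int n * j)" for n :: nat
    by (induction n) (simp_all add: one_eq mult_eq algebra_simps)
  show ?thesis
    by (cases k rule: int_cases2) (simp_all add: int_pow_int int_pow_neg_int nat inv_eq)
qed

lemma mem_C_iff: "m i j \<in> C k l \<longleftrightarrow> (\<exists>t. [i = t * k] (mod 2 ^ a) \<and> [j = t * l] (mod 2 ^ b))"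
  by (auto simp: powers_def pow_eq eq_iff)

lemma C_subset_iff: "C i j \<subseteq> C k l \<longleftrightarrow> (\<exists>t. [i = t * k] (mod 2 ^ a) \<and> [j = t * l] (mod 2 ^ b))"
  by (simp add: powers_subset_iff mem_C_iff)

lemma exponent: "m i j [^] ((2::int) ^ (a + b)) = \<one>"
  by (simp add: pow_eq one_eq eq_iff cong_0_iff power_add)

lemma C_odd_multiple: "odd u \<Longrightarrow> C (u * i) (u * j) = C i j"
  using powers_odd_pow[OF m_closed exponent] by (simp add: pow_eq)

text \<open>
  If a multiple \<open>t (k, l)\<close> has an odd coordinate, then \<open>t\<close> is odd and the multiple generates as much as
  \<open>(k, l)\<close> does.
\<close>

lemma C_eqI_primitive:
  assumes "odd i \<or> odd j" "C i j \<subseteq> C k l"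
  shows "C i j = C k l"
proof -
  obtain t where t: "[i = t * k] (mod 2 ^ a)" "[j = t * l] (mod 2 ^ b)"
    using assms(2) C_subset_iff by blast
  have "odd t" using odd_if_cong_odd[OF t(1) a_pos] odd_if_cong_odd[OF t(2) b_pos] assms(1) by auto
  moreover have "m i j = m (t * k) (t * l)" using t by (simp add: eq_iff)
  ultimately show ?thesis using C_odd_multiple by simp
qed

text \<open>
  Dividing the coordinates by their greatest common divisor leaves at least one of them odd.
\<close>

lemma C_subset_primitive: "\<exists>k l. (odd k \<or> odd l) \<and> C i j \<subseteq> C k l"
proof (cases "gcd i j = 0")
  case True
  then have "C i j \<subseteq> C 1 0" unfolding C_subset_iff by (intro exI[of _ 0]) simp
  then show ?thesis using odd_one by blast
next
  case False
  then obtain k l where kl: "i = k * gcd i j" "j = l * gcd i j" "coprime k l"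
    using gcd_coprime_exists by blast
  have "odd k \<or> odd l" using coprime_common_divisor[OF kl(3), of 2] by auto
  moreover have "C i j \<subseteq> C k l"
    unfolding C_subset_iff using kl by (intro exI[of _ "gcd i j"]) (metis cong_refl mult.commute)
  ultimately show ?thesis by blast
qed

lemma maximal_iff_primitive:
  "maximal_cyclic_subgroup H A \<longleftrightarrow> (\<exists>i j. H = C i j \<and> (odd i \<or> odd j))"
proof
  assume "maximal_cyclic_subgroup H A"
  then have max: "\<exists>g\<in>carrier A. H = powers A g" "\<forall>h\<in>carrier A. H \<subseteq> powers A h \<longrightarrow> H = powers A h"
    by (simp_all add: maximal_cyclic_subgroup_iff)
  obtain i j where "H = C i j" using max(1) by (auto simp: carrier_eq)
  then obtain k l where "odd k \<or> odd l" "H \<subseteq> C k l" using C_subset_primitive by blast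
  then show "\<exists>i j. H = C i j \<and> (odd i \<or> odd j)" using max(2) m_closed by blast
next
  assume "\<exists>i j. H = C i j \<and> (odd i \<or> odd j)"
  then obtain i j where H: "H = C i j" "odd i \<or> odd j" by blast
  have "H = powers A h" if "h \<in> carrier A" "H \<subseteq> powers A h" for h
  proof -
    obtain k l where "h = m k l" using \<open>h \<in> carrier A\<close> by (auto simp: carrier_eq)
    then show ?thesis using that(2) H C_eqI_primitive by simp
  qed
  then show "maximal_cyclic_subgroup H A"
    using H(1) by (auto simp: maximal_cyclic_subgroup_iff)
qed

lemma maximal_cyclic_subgroups:
  "{H. maximal_cyclic_subgroup H A} = {C i j |i j. odd i \<or> odd j}"
  by (simp only: maximal_iff_primitive)

text \<open>
  An odd coordinate becomes 1 after multiplication by its inverse.  The second family takes only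
  the generators with even first coordinate, which makes the two families disjoint.
\<close>

lemma C_primitive_normal_form:
  "{C i j |i j. odd i \<or> odd j} = range (C 1) \<union> range (\<lambda>i. C (2 * i) 1)"
proof (intro equalityI subsetI)
  fix H assume "H \<in> {C i j |i j. odd i \<or> odd j}"
  then obtain i j where H: "H = C i j" "odd i \<or> odd j" by blast
  show "H \<in> range (C 1) \<union> range (\<lambda>i. C (2 * i) 1)"
  proof (cases "odd i")
    case True
    then obtain s where s: "[i * s = 1] (mod 2 ^ a)" by (rule odd_inverse_mod_power_2)
    then have "odd s" using odd_if_cong_odd[OF s a_pos] by simp
    then have "H = C (s * i) (s * j)" using H C_odd_multiple by simp
    also have "m (s * i) (s * j) = m 1 (s * j)" using s by (simp add: eq_iff mult.commute)
    finally show ?thesis by blast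
  next
    case False
    then have "odd j" using H by blast
    then obtain s where s: "[j * s = 1] (mod 2 ^ b)" by (rule odd_inverse_mod_power_2)
    then have "odd s" using odd_if_cong_odd[OF s b_pos] by simp
    then have "H = C (s * i) (s * j)" using H C_odd_multiple by simp
    also have "m (s * i) (s * j) = m (2 * (s * (i div 2))) 1"
      using s False by (simp add: eq_iff mult.commute mult.left_commute[of 2])
    finally show ?thesis by blast
  qed
next
  fix H assume "H \<in> range (C 1) \<union> range (\<lambda>i. C (2 * i) 1)"
  then show "H \<in> {C i j |i j. odd i \<or> odd j}" using odd_one by blast
qed

lemma maximal_normal_form:
  assumes "maximal_cyclic_subgroup H A"
  obtains j where "H = C 1 j" | i where "H = C (2 * i) 1"
proof -
  have "H \<in> range (C 1) \<union> range (\<lambda>i. C (2 * i) 1)"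
    using assms unfolding C_primitive_normal_form[symmetric] maximal_cyclic_subgroups[symmetric]
    by simp
  then show thesis using that by auto
qed

text \<open>
  The coordinate 1 of both generators forces the multiplier between them to be 1 modulo \<open>2\<^sup>a\<close>.
\<close>

lemma C_1_eq_iff: "C 1 j = C 1 j' \<longleftrightarrow> dilation_class a b j = dilation_class a b j'"
proof -
  have "C 1 j = C 1 j' \<longleftrightarrow> C 1 j' \<subseteq> C 1 j" using C_eqI_primitive[of 1 j' 1 j] by auto
  also have "\<dots> \<longleftrightarrow> dilation_class a b j = dilation_class a b j'"
    by (simp add: C_subset_iff dilation_class_eq_iff[OF a_pos] cong_sym_eq[of 1])
  finally show ?thesis .
qed

lemma C_even_1_eq_iff:
  "C (2 * i) 1 = C (2 * i') 1 \<longleftrightarrow> dilation_class b (a - 1) i = dilation_class b (a - 1) i'"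
proof -
  have "C (2 * i) 1 = C (2 * i') 1 \<longleftrightarrow> C (2 * i') 1 \<subseteq> C (2 * i) 1"
    using C_eqI_primitive[of "2 * i'" 1 "2 * i" 1] by auto
  also have "\<dots> \<longleftrightarrow> dilation_class b (Suc (a - 1)) (2 * i) = dilation_class b (Suc (a - 1)) (2 * i')"
    using a_pos by (auto simp add: C_subset_iff dilation_class_eq_iff[OF b_pos] cong_sym_eq[of 1])
  finally show ?thesis by (simp only: even_dilation_class_eq_iff[OF b_pos])
qed

lemma finite_card_maximal_cyclic_subgroups:
  "finite {H. maximal_cyclic_subgroup H A}"
  "card {H. maximal_cyclic_subgroup H A} = g2 a b"
proof -
  have 1: "card (range (C 1)) = card (range (dilation_class a b))" "finite (range (C 1))"
    using card_image_eq_if_same_kernel[of UNIV "C 1" "dilation_class a b", OF C_1_eq_iff]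
      finite_card_dilation_classes[OF a_pos, of b] by simp_all
  have 2: "card (range (\<lambda>i. C (2 * i) 1)) = card (range (dilation_class b (a - 1)))"
    "finite (range (\<lambda>i. C (2 * i) 1))"
    using card_image_eq_if_same_kernel[of UNIV "\<lambda>i. C (2 * i) 1" "dilation_class b (a - 1)",
        OF C_even_1_eq_iff] finite_card_dilation_classes[OF b_pos, of "a - 1"] by simp_all
  have "C 1 j \<noteq> C (2 * i) 1" for i j
  proof
    assume "C 1 j = C (2 * i) 1"
    then obtain t where "[1 = t * (2 * i)] (mod 2 ^ a)" using C_subset_iff[of 1 j "2 * i" 1] by auto
    then show False using odd_if_cong_odd[OF _ a_pos, of 1 "t * (2 * i)"] by simp
  qed
  then have disjoint: "range (C 1) \<inter> range (\<lambda>i. C (2 * i) 1) = {}" by blast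
  show "finite {H. maximal_cyclic_subgroup H A}"
    unfolding maximal_cyclic_subgroups C_primitive_normal_form using 1 2 by simp
  show "card {H. maximal_cyclic_subgroup H A} = g2 a b"
    unfolding maximal_cyclic_subgroups C_primitive_normal_form
      card_Un_disjoint[OF 1(2) 2(2) disjoint] 1(1) 2(1)
    by (rule dilation_classes_sum_eq_g2[OF a_pos b_pos])
qed

lemma eta_eq_g2: "eta A = g2 a b"
proof -
  have conj: "conjugate A u H = H" if u: "u \<in> carrier A" and H: "maximal_cyclic_subgroup H A" for u H
  proof -
    obtain g where g: "g \<in> carrier A" "H = powers A g"
      using H maximal_cyclic_subgroup_iff by blast
    have "u \<otimes> g \<otimes> inv u = g"
      using u g(1) by (auto simp: carrier_eq mult_eq inv_eq)
    then show ?thesis using conjugate_powers[OF u g(1)] g(2) by simp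
  qed
  have "(\<lambda>u. conjugate A u H) ` carrier A = {H}" if "maximal_cyclic_subgroup H A" for H
    using conj that by auto
  then have "eta A = card ((\<lambda>H. {H}) ` {H. maximal_cyclic_subgroup H A})"
    unfolding eta_eq by (auto intro!: arg_cong[where f = card] image_cong)
  then show ?thesis using finite_card_maximal_cyclic_subgroups(2) by (simp add: card_image)
qed

end

section \<open>Split metacyclic 2-groups of negative type in coordinates\<close>

text \<open>
  Here \<open>e i j\<close> stands for \<open>x\<^sup>i y\<^sup>j\<close>, \<open>a\<close> for \<open>\<alpha>\<close> and \<open>b\<close> for \<open>\<beta> - 1\<close>.  For \<open>r = 2\<^bsup>\<alpha> - \<delta>\<^esup> - 1\<close> the condition
  \<open>4 dvd r + 1\<close> says \<open>\<alpha> - \<delta> \<ge> 2\<close>, and \<open>2 ^ a dvd 2 * (r + 1)\<close> says \<open>\<delta> \<le> 1\<close>.  Conjugation by \<open>y\<close> and by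
  its inverse agree because \<open>r\<^sup>2\<close> is 1 modulo \<open>2\<^sup>a\<close>, so the multiplication rule involves only the
  parity of \<open>j\<close>.
\<close>

locale negative_metacyclic_2_group = group G for G (structure) +
  fixes e :: "int \<Rightarrow> int \<Rightarrow> 'a" and r :: int and a b :: nat
  assumes carrier_eq: "carrier G = (\<Union>i. range (e i))"
    and mult_eq: "e i j \<otimes> e k l = e (i + (if even j then k else r * k)) (j + l)"
    and eq_iff: "e i j = e k l \<longleftrightarrow> [i = k] (mod 2 ^ a) \<and> [j = l] (mod 2 ^ Suc b)"
    and r_mod_4: "4 dvd r + 1"
    and r_near_minus_1: "2 ^ a dvd 2 * (r + 1)"
    and a_ge_2: "a \<ge> 2" and b_ge_2: "b \<ge> 2"
begin

lemma odd_r: "odd r"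
  using r_mod_4 by presburger

lemma r_squared: "[r * r = 1] (mod 2 ^ a)"
proof -
  obtain q where "r = 2 * q + 1" using odd_r by (rule oddE)
  then have "r * r - 1 = 2 * (r + 1) * q" by (simp add: algebra_simps)
  then show ?thesis using r_near_minus_1 by (simp add: cong_iff_dvd_diff)
qed

lemma e_closed [simp]: "e i j \<in> carrier G"
  using carrier_eq by blast

lemma one_eq: "\<one> = e 0 0"
proof -
  have "e 0 0 \<otimes> e 0 0 = e 0 0" by (simp add: mult_eq)
  then show ?thesis by (simp add: l_cancel_one)
qed

lemma inv_eq: "inv (e i j) = e (- (if even j then i else r * i)) (- j)"
  by (rule inv_equality) (simp_all add: mult_eq one_eq)

lemma pow_even_eq: "e i (2 * j) [^] (k::int) = e (k * i) (2 * (k * j))"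
proof -
  have nat: "e i (2 * j) [^] n = e (int n * i) (2 * (int n * j))" for n :: nat
    by (induction n) (simp_all add: one_eq mult_eq algebra_simps)
  show ?thesis
    by (cases k rule: int_cases2) (simp_all add: int_pow_int int_pow_neg_int nat inv_eq)
qed

lemma square_eq: "e i j [^] (2::int) = e (i + (if even j then i else r * i)) (2 * j)"
  using int_pow_mult[OF e_closed, of i j 1 1] by (simp add: mult_eq)

text \<open>
  These are the powers of the square \<open>(x\<^sup>i y)\<^sup>2 = x\<^bsup>(1 + r) i\<^esup> y\<^sup>2\<close>.
\<close>

lemma pow_even_of_odd: "e i 1 [^] (2 * k::int) = e (k * ((1 + r) * i)) (2 * k)"
proof -
  have "e i 1 [^] (2 * k) = (e i 1 [^] (2::int)) [^] k" by (simp add: int_pow_pow)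
  also have "\<dots> = e (k * ((1 + r) * i)) (2 * k)"
    using pow_even_eq[of "(1 + r) * i" 1 k] by (simp add: square_eq algebra_simps)
  finally show ?thesis .
qed

lemma pow_odd_of_odd: "e i 1 [^] (2 * k + 1::int) = e (k * ((1 + r) * i) + i) (2 * k + 1)"
  using int_pow_mult[OF e_closed, of i 1 "2 * k" 1] by (simp add: pow_even_of_odd mult_eq)

lemma pow_second_coordinate: "\<exists>i'. e i j [^] (n::int) = e i' (n * j)"
proof -
  have nat: "\<exists>i'. e i j [^] n = e i' (int n * j)" for n :: nat
  proof (induction n)
    case 0
    show ?case by (auto simp: one_eq)
  next
    case (Suc n)
    then obtain i' where "e i j [^] n = e i' (int n * j)" by blast
    then have "e i j [^] Suc n = e i' (int n * j) \<otimes> e i j" by simp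
    then show ?case unfolding mult_eq by (metis add.commute distrib_right mult_1 of_nat_Suc)
  qed
  show ?thesis
  proof (cases n rule: int_cases2)
    case (nonneg k)
    then show ?thesis using nat[of k] by (simp add: int_pow_int)
  next
    case (nonpos k)
    obtain i' where "e i j [^] k = e i' (int k * j)" using nat by blast
    then have "e i j [^] n = inv (e i' (int k * j))" using nonpos by (simp add: int_pow_neg_int)
    then show ?thesis unfolding inv_eq nonpos by auto
  qed
qed

lemma exponent: "e i j [^] ((2::int) ^ Suc (a + b)) = \<one>"
proof -
  have "e i j [^] ((2::int) ^ Suc (a + b)) = (e i j [^] (2::int)) [^] ((2::int) ^ (a + b))"
    by (simp add: int_pow_pow)
  also have "\<dots> = \<one>"
    unfolding square_eq pow_even_eq one_eq eq_iff
    by (simp add: cong_0_iff power_add mult.assoc)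
  finally show ?thesis .
qed

definition M where "M = subgroup_generated G {e 1 0, e 0 2}"

lemma carrier_M: "carrier M = (\<Union>i. range (\<lambda>j. e i (2 * j)))"
proof
  let ?S = "\<Union>i. range (\<lambda>j. e i (2 * j))"
  have "subgroup ?S G"
  proof (rule subgroupI)
    fix u assume "u \<in> ?S"
    then obtain i j where u: "u = e i (2 * j)" by blast
    have "inv u = e (- i) (2 * (- j))" by (simp add: u inv_eq)
    then show "inv u \<in> ?S" by blast
    fix v assume "v \<in> ?S"
    then obtain k l where v: "v = e k (2 * l)" by blast
    have "u \<otimes> v = e (i + k) (2 * (j + l))" by (simp add: u v mult_eq distrib_left)
    then show "u \<otimes> v \<in> ?S" by blast
  qed auto
  moreover have "{e 1 0, e 0 2} \<subseteq> ?S"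
  proof -
    have "e 1 0 = e 1 (2 * 0)" "e 0 2 = e 0 (2 * 1)" by simp_all
    then show ?thesis by blast
  qed
  ultimately show "carrier M \<subseteq> ?S" unfolding M_def by (intro subgroup_generated_minimal)
next
  interpret H: group M unfolding M_def by simp
  have gen: "e 1 0 \<in> carrier M" "e 0 2 \<in> carrier M"
    unfolding M_def using subgroup_generated_subset_carrier_subset[of "{e 1 0, e 0 2}"] by auto
  show "(\<Union>i. range (\<lambda>j. e i (2 * j))) \<subseteq> carrier M"
  proof clarify
    fix i j
    have "e i (2 * j) = e 1 0 [^] i \<otimes> e 0 2 [^] j"
      using pow_even_eq[of 1 0 i] pow_even_eq[of 0 1 j] by (simp add: mult_eq)
    also have "\<dots> = e 1 0 [^]\<^bsub>M\<^esub> i \<otimes>\<^bsub>M\<^esub> e 0 2 [^]\<^bsub>M\<^esub> j"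
      using gen unfolding M_def by (simp add: int_pow_subgroup_generated)
    also have "\<dots> \<in> carrier M" using gen by simp
    finally show "e i (2 * j) \<in> carrier M" .
  qed
qed

lemma powers_M: "g \<in> carrier M \<Longrightarrow> powers M g = powers G g"
  unfolding M_def powers_def by (simp add: int_pow_subgroup_generated)

sublocale M: rank_two_abelian_2_group M "\<lambda>i j. e i (2 * j)" a b
proof -
  interpret H: group M unfolding M_def by simp
  have "monoid.mult M = monoid.mult G" by (simp add: M_def)
  moreover have "[2 * j = 2 * l] (mod 2 ^ Suc b) \<longleftrightarrow> [j = l] (mod 2 ^ b)" for j l :: int
    unfolding cong_iff_dvd_diff power_Suc right_diff_distrib[symmetric] dvd_mult_cancel_left by simp
  ultimately show "rank_two_abelian_2_group M (\<lambda>i j. e i (2 * j)) a b"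
    using a_ge_2 b_ge_2 by unfold_locales (simp_all add: carrier_M mult_eq eq_iff distrib_left)
qed

lemma C_M_eq: "M.C i j = powers G (e i (2 * j))"
  by (rule powers_M) (simp add: M.m_closed)

abbreviation "D i \<equiv> powers G (e i 1)"

lemma e_in_carrier_M_iff: "e i j \<in> carrier M \<longleftrightarrow> even j"
proof
  assume "e i j \<in> carrier M"
  then obtain k l where "e i j = e k (2 * l)" by (auto simp: carrier_M)
  then have "[j = 2 * l] (mod 2 ^ Suc b)" by (simp add: eq_iff)
  then show "even j" using odd_if_cong_odd by fastforce
next
  assume "even j"
  then obtain l where "j = 2 * l" by (rule evenE)
  then show "e i j \<in> carrier M" by (auto simp: carrier_M)
qed

lemma D_not_subset_M: "\<not> D i \<subseteq> carrier M"
  using self_in_powers[of "e i 1"] e_in_carrier_M_iff[of i 1] by auto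

lemma powers_odd_eq_D:
  assumes "odd j"
  shows "\<exists>i'. powers G (e i j) = D i'"
proof -
  obtain s where s: "[j * s = 1] (mod 2 ^ Suc b)" using assms by (rule odd_inverse_mod_power_2)
  have "odd s" using odd_if_cong_odd[OF s] by simp
  obtain i' where i': "e i j [^] s = e i' (s * j)" using pow_second_coordinate by blast
  have "e i' (s * j) = e i' 1" using s by (simp add: eq_iff mult.commute)
  then show ?thesis using powers_odd_pow[OF e_closed exponent \<open>odd s\<close>, of i j] i' by auto
qed

text \<open>
  The second coordinate of \<open>e i 1\<close> is odd, so \<open>e i 1\<close> can only be an odd power, and odd powers
  generate the same subgroup in a 2-group.
\<close>

lemma D_maximal:
  assumes "h \<in> carrier G" "D i \<subseteq> powers G h"
  shows "D i = powers G h"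
proof -
  obtain k l where h: "h = e k l" using assms(1) by (auto simp: carrier_eq)
  obtain n :: int where n: "e i 1 = h [^] n"
    using assms self_in_powers[of "e i 1"] by (auto simp: powers_def)
  obtain i' where "h [^] n = e i' (n * l)" using pow_second_coordinate h by blast
  then have "[1 = n * l] (mod 2 ^ Suc b)" using n by (simp add: eq_iff)
  then have "odd n" using odd_if_cong_odd[of 1 "n * l" "Suc b"] by simp
  then show ?thesis using powers_odd_pow[OF e_closed exponent] n h by simp
qed

lemma squares_of_D: "M.C ((1 + r) * k) 1 \<subseteq> D k"
proof -
  have "e ((1 + r) * k) (2 * 1) = e k 1 [^] (2::int)" using pow_even_of_odd[of k 1] by simp
  then have "e ((1 + r) * k) (2 * 1) \<in> D k" unfolding powers_def by (metis rangeI)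
  then show ?thesis unfolding C_M_eq by (simp only: powers_subset_iff e_closed)
qed

text \<open>
  An element of \<open>M\<close> among the powers of \<open>e k 1\<close> is an even power, by its second coordinate.
\<close>

lemma C_subset_D_imp:
  assumes "M.C i j \<subseteq> D k"
  shows "M.C i j \<subseteq> M.C ((1 + r) * k) 1"
proof -
  have "e i (2 * j) \<in> D k" using assms unfolding C_M_eq by (simp only: powers_subset_iff e_closed)
  then obtain n :: int where n: "e i (2 * j) = e k 1 [^] n" by (auto simp: powers_def)
  obtain i' where "e k 1 [^] n = e i' n" using pow_second_coordinate[of k 1 n] by auto
  then have "[2 * j = n] (mod 2 ^ Suc b)" using n by (simp add: eq_iff)
  then have "even n" using odd_if_cong_odd[of "2 * j" n "Suc b"] by simp
  then obtain t where t: "n = 2 * t" by (rule evenE)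
  have "e i (2 * j) = e ((1 + r) * k) (2 * 1) [^] t"
    unfolding n t pow_even_of_odd pow_even_eq by simp
  then have "e i (2 * j) \<in> powers G (e ((1 + r) * k) (2 * 1))" by (auto simp: powers_def)
  then show ?thesis unfolding C_M_eq by (simp only: powers_subset_iff e_closed)
qed

text \<open>
  The maximal cyclic subgroups of \<open>M\<close> that are no longer maximal in \<open>G\<close>: they are generated by
  the squares of the elements \<open>x\<^sup>k y\<close>.
\<close>

definition "absorbed = range (\<lambda>k. M.C ((1 + r) * k) 1)"

text \<open>
  A cyclic subgroup with a generator outside \<open>M\<close> meets \<open>M\<close> in the powers of the square of that
  generator, so it can only swallow a maximal cyclic subgroup of \<open>M\<close> that is generated by this square.
\<close>

lemma maximal_cyclic_subgroups_G:
  "{H. maximal_cyclic_subgroup H G} = range D \<union> ({H. maximal_cyclic_subgroup H M} - absorbed)"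
proof (intro equalityI subsetI)
  fix H assume "H \<in> {H. maximal_cyclic_subgroup H G}"
  then have cyc: "\<exists>g\<in>carrier G. H = powers G g"
    and max: "\<And>h. h \<in> carrier G \<Longrightarrow> H \<subseteq> powers G h \<Longrightarrow> H = powers G h"
    by (simp_all add: maximal_cyclic_subgroup_iff)
  obtain i j where H: "H = powers G (e i j)" using cyc by (auto simp: carrier_eq)
  show "H \<in> range D \<union> ({H. maximal_cyclic_subgroup H M} - absorbed)"
  proof (cases "even j")
    case False
    then show ?thesis using powers_odd_eq_D H by blast
  next
    case True
    then have g: "e i j \<in> carrier M" by (simp add: e_in_carrier_M_iff)
    have "H = powers M h" if "h \<in> carrier M" "H \<subseteq> powers M h" for h
    proof -
      have "h \<in> carrier G" using that(1) by (auto simp: carrier_M)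
      then show ?thesis using max that(2) powers_M[OF that(1)] by simp
    qed
    moreover have "H = powers M (e i j)" using H powers_M[OF g] by simp
    ultimately have "maximal_cyclic_subgroup H M"
      unfolding M.maximal_cyclic_subgroup_iff using g by blast
    moreover have "H \<notin> absorbed"
    proof
      assume "H \<in> absorbed"
      then obtain k where "H = M.C ((1 + r) * k) 1" by (auto simp: absorbed_def)
      then have "H = D k" using squares_of_D max by simp
      moreover have "H \<subseteq> carrier M"
        using M.powers_subset_carrier[OF g] \<open>H = powers M (e i j)\<close> by simp
      ultimately show False using D_not_subset_M by simp
    qed
    ultimately show ?thesis by blast
  qed
next
  fix H assume "H \<in> range D \<union> ({H. maximal_cyclic_subgroup H M} - absorbed)"
  then consider i where "H = D i" | "maximal_cyclic_subgroup H M" "H \<notin> absorbed" by blast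
  then have "maximal_cyclic_subgroup H G"
  proof cases
    case 1
    then show ?thesis using D_maximal by (auto simp: maximal_cyclic_subgroup_iff)
  next
    case 2
    then obtain i j where H: "H = M.C i j" and prim: "odd i \<or> odd j"
      using M.maximal_iff_primitive by metis
    have "H = powers G h" if h: "h \<in> carrier G" "H \<subseteq> powers G h" for h
    proof -
      obtain k l where kl: "h = e k l" using h(1) by (auto simp: carrier_eq)
      show ?thesis
      proof (cases "even l")
        case True
        then have "h \<in> carrier M" using kl by (simp add: e_in_carrier_M_iff)
        then show ?thesis
          using 2(1) h(2) powers_M[of h] unfolding M.maximal_cyclic_subgroup_iff by blast
      next
        case False
        then obtain k' where "powers G h = D k'" using powers_odd_eq_D kl by blast
        then have "H \<subseteq> M.C ((1 + r) * k') 1" using C_subset_D_imp h(2) H by simp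
        then have "H = M.C ((1 + r) * k') 1" using M.C_eqI_primitive[OF prim] H by blast
        then show ?thesis using 2(2) by (auto simp: absorbed_def)
      qed
    qed
    moreover have "H = powers G (e i (2 * j))" using H C_M_eq by simp
    ultimately show ?thesis using e_closed unfolding maximal_cyclic_subgroup_iff by blast
  qed
  then show "H \<in> {H. maximal_cyclic_subgroup H G}" by simp
qed

lemma conjugate_C:
  "conjugate G (e k l) (M.C i j) = M.C (if even l then i else r * i) j"
proof -
  have "[- (k * (r * r)) = - k] (mod 2 ^ a)"
    using cong_scalar_left[OF r_squared, of "- k"] by simp
  then have sq: "[r * i + (k - r * (r * k)) = r * i] (mod 2 ^ a)"
    by (simp add: cong_iff_dvd_diff algebra_simps)
  have "e k l \<otimes> e i (2 * j) \<otimes> inv (e k l) = e (if even l then i else r * i) (2 * j)"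
    using sq by (simp add: inv_eq mult_eq eq_iff algebra_simps)
  then show ?thesis unfolding C_M_eq by (simp add: conjugate_powers)
qed

lemma conjugates_of_C:
  "(\<lambda>u. conjugate G u (M.C i j)) ` carrier G = {M.C i j, conjugate G (e 0 1) (M.C i j)}"
proof (intro equalityI subsetI)
  fix H assume "H \<in> (\<lambda>u. conjugate G u (M.C i j)) ` carrier G"
  then obtain k l where "H = conjugate G (e k l) (M.C i j)" by (auto simp: carrier_eq)
  then show "H \<in> {M.C i j, conjugate G (e 0 1) (M.C i j)}"
    by (cases "even l") (simp_all add: conjugate_C)
next
  have "M.C i j = conjugate G (e 0 0) (M.C i j)" by (simp add: conjugate_C)
  then show "H \<in> (\<lambda>u. conjugate G u (M.C i j)) ` carrier G"
    if "H \<in> {M.C i j, conjugate G (e 0 1) (M.C i j)}" for H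
    using that e_closed by blast
qed

lemma conjugate_D:
  "conjugate G (e k l) (D i) = D ((if even l then i else r * i) + (1 - r) * k)"
proof -
  have "[r * (r * k) = k] (mod 2 ^ a)"
    using cong_scalar_right[OF r_squared, of k] by (simp add: mult.assoc)
  then have "e k l \<otimes> e i 1 \<otimes> inv (e k l) = e ((if even l then i else r * i) + (1 - r) * k) 1"
    by (simp add: inv_eq mult_eq eq_iff algebra_simps)
  then show ?thesis by (simp add: conjugate_powers)
qed

lemma D_eq_imp_same_parity:
  assumes "D i = D i'"
  shows "even i \<longleftrightarrow> even i'"
proof -
  obtain n :: int where n: "e i' 1 = e i 1 [^] n"
    using assms self_in_powers[of "e i' 1"] by (auto simp: powers_def)
  obtain i'' where "e i 1 [^] n = e i'' n" using pow_second_coordinate[of i 1 n] by auto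
  then have "[1 = n] (mod 2 ^ Suc b)" using n by (simp add: eq_iff)
  then have "odd n" using odd_if_cong_odd[of 1 n "Suc b"] by simp
  then obtain k where "n = 2 * k + 1" by (rule oddE)
  then have "[i' = k * ((1 + r) * i) + i] (mod 2 ^ a)"
    using n pow_odd_of_odd by (simp add: eq_iff)
  then show ?thesis using odd_if_cong_odd[of i' _ a] a_ge_2 odd_r by fastforce
qed

text \<open>
  Conjugation by \<open>x\<^sup>k\<close> adds \<open>(1 - r) k\<close> to the exponent \<open>i\<close>, and \<open>1 - r\<close> is twice an odd number, so
  every exponent of the same parity is reached.
\<close>

lemma conjugates_of_D:
  "(\<lambda>u. conjugate G u (D i)) ` carrier G = D ` {i'. even i' \<longleftrightarrow> even i}"
proof (intro equalityI subsetI)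
  fix H assume "H \<in> (\<lambda>u. conjugate G u (D i)) ` carrier G"
  then show "H \<in> D ` {i'. even i' \<longleftrightarrow> even i}"
    using odd_r by (auto simp: carrier_eq conjugate_D)
next
  fix H assume "H \<in> D ` {i'. even i' \<longleftrightarrow> even i}"
  then obtain i' where i': "even i' \<longleftrightarrow> even i" "H = D i'" by blast
  obtain q where "r + 1 = 4 * q" using r_mod_4 by (rule dvdE)
  then have q: "r = 4 * q - 1" by simp
  have "odd (1 - 2 * q)" by simp
  then obtain s where s: "[(1 - 2 * q) * s = 1] (mod 2 ^ a)" by (rule odd_inverse_mod_power_2)
  have "even (i' - i)" using i'(1) by simp
  then obtain d where d: "i' - i = 2 * d" by (rule evenE)
  have "(1 - r) * (s * d) = ((1 - 2 * q) * s) * (i' - i)"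
    unfolding q d by (simp add: algebra_simps)
  then have "[i + (1 - r) * (s * d) = i + 1 * (i' - i)] (mod 2 ^ a)"
    using s by (simp only:) (intro cong_add cong_scalar_right cong_refl)
  then have "e (i + (1 - r) * (s * d)) 1 = e i' 1" by (simp add: eq_iff)
  then have "conjugate G (e (s * d) 0) (D i) = H" using i'(2) by (simp add: conjugate_D)
  then show "H \<in> (\<lambda>u. conjugate G u (D i)) ` carrier G" using e_closed by blast
qed

text \<open>
  The maximal cyclic subgroups of \<open>M\<close> that are normal in \<open>G\<close>; in terms of the generators of \<open>G\<close>
  they are generated by \<open>x\<close>, \<open>x y ^ (2 ^ b)\<close>, \<open>y\<^sup>2\<close> and \<open>x ^ (2 ^ (a - 1)) y\<^sup>2\<close>.
\<close>

definition "normal_maximal = {M.C 1 0, M.C 1 (2 ^ (b - 1)), M.C 0 1, M.C (2 ^ (a - 1)) 1}"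

lemma C_1_neq_C_even: "even i \<Longrightarrow> M.C 1 j \<noteq> M.C i j'"
proof
  assume "even i" "M.C 1 j = M.C i j'"
  then obtain t where "[1 = t * i] (mod 2 ^ a)" using M.C_subset_iff[of 1 j i j'] by auto
  then show False using odd_if_cong_odd[of 1 "t * i" a] a_ge_2 \<open>even i\<close> by simp
qed

lemma C_half_1_neq: "M.C (2 ^ (a - 1)) 1 \<noteq> M.C 0 1"
  using half_modulus_not_cong_0[of a] a_ge_2 M.C_subset_iff[of "2 ^ (a - 1)" 1 0 1] by auto

lemma card_normal_maximal: "card normal_maximal = 4"
proof -
  have half_b_neq: "M.C 1 (2 ^ (b - 1)) \<noteq> M.C 1 0"
    using half_modulus_not_cong_0[of b] b_ge_2 M.C_subset_iff[of 1 "2 ^ (b - 1)" 1 0] by auto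
  have half_even: "even ((2::int) ^ (a - 1))" using a_ge_2 by simp
  have card_4: "card {P, Q, U, V} = 4"
    if "Q \<noteq> P" "V \<noteq> U" "P \<noteq> U" "P \<noteq> V" "Q \<noteq> U" "Q \<noteq> V" for P Q U V :: "'a set"
    using that by simp
  show ?thesis
    unfolding normal_maximal_def
    by (rule card_4[OF half_b_neq C_half_1_neq C_1_neq_C_even C_1_neq_C_even[OF half_even]
          C_1_neq_C_even C_1_neq_C_even[OF half_even]]) (rule dvd_0_right)+
qed

lemma multiplier_minus_1_odd_double:
  assumes "[t = r] (mod 2 ^ n)" "n \<ge> 2"
  shows "[1 - t = 2] (mod 4)"
proof -
  have "(4::int) dvd 2 ^ n" using le_imp_power_dvd[OF assms(2), of "2::int"] by simp
  then have "[t = r] (mod 4)" using assms(1) by (rule cong_dvd_modulus[rotated])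
  then have "4 dvd t - r" by (simp add: cong_iff_dvd_diff)
  then show ?thesis using r_mod_4 unfolding cong_iff_dvd_diff by presburger
qed

text \<open>
  Conjugation by \<open>y\<close> multiplies the first coordinate by \<open>r\<close> and keeps the second.  If that amounts
  to multiplying a generator by \<open>t\<close>, then a coordinate equal to 1 forces \<open>t\<close> to be \<open>r\<close> or 1.  The
  multipliers \<open>r\<close> and 1 differ by twice an odd number, even after changing \<open>t\<close> by the modulus,
  which is a multiple of 4.  So the other coordinate is killed by 2.
\<close>

lemma normal_maximal_iff:
  "H \<in> normal_maximal \<longleftrightarrow> maximal_cyclic_subgroup H M \<and> conjugate G (e 0 1) H = H"
proof
  assume "maximal_cyclic_subgroup H M \<and> conjugate G (e 0 1) H = H"
  then have max: "maximal_cyclic_subgroup H M" and fixed: "conjugate G (e 0 1) H = H" by simp_all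
  from max show "H \<in> normal_maximal"
  proof (cases rule: M.maximal_normal_form)
    case (1 j)
    then have "M.C r j \<subseteq> M.C 1 j" using fixed conjugate_C[of 0 1 1 j] by simp
    then obtain t where t: "[r = t] (mod 2 ^ a)" "[j = t * j] (mod 2 ^ b)"
      using M.C_subset_iff[of r j 1 j] by auto
    have "2 ^ b dvd (1 - t) * j" using t(2) by (simp add: cong_iff_dvd_diff left_diff_distrib)
    then have "2 ^ b dvd 2 * j"
      using multiplier_minus_1_odd_double[OF cong_sym[OF t(1)] a_ge_2]
      by (rule power_2_dvd_2_mult_if_dvd_twice_odd_mult)
    then have "[j = 0] (mod 2 ^ b) \<or> [j = 2 ^ (b - 1)] (mod 2 ^ b)"
      using b_ge_2 by (intro cong_half_modulus_cases) auto
    then have "e 1 (2 * j) = e 1 (2 * 0) \<or> e 1 (2 * j) = e 1 (2 * 2 ^ (b - 1))"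
      by (simp only: M.eq_iff) simp
    then show ?thesis using 1 unfolding normal_maximal_def by auto
  next
    case (2 i)
    then have "M.C (r * (2 * i)) 1 \<subseteq> M.C (2 * i) 1" using fixed conjugate_C[of 0 1 "2 * i" 1] by simp
    then obtain t where t: "[r * (2 * i) = t * (2 * i)] (mod 2 ^ a)" "[1 = t] (mod 2 ^ b)"
      using M.C_subset_iff[of "r * (2 * i)" 1 "2 * i" 1] by auto
    have "(4::int) dvd 2 ^ b" using le_imp_power_dvd[OF b_ge_2, of "2::int"] by simp
    then have "4 dvd 1 - t" using t(2) by (meson cong_iff_dvd_diff dvd_trans)
    then have "[t - r = 2] (mod 4)" using r_mod_4 unfolding cong_iff_dvd_diff by presburger
    moreover have "2 ^ a dvd (t - r) * (2 * i)"
      using cong_sym[OF t(1)] unfolding cong_iff_dvd_diff left_diff_distrib .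
    ultimately have "2 ^ a dvd 2 * (2 * i)" by (intro power_2_dvd_2_mult_if_dvd_twice_odd_mult)
    then have "[2 * i = 0] (mod 2 ^ a) \<or> [2 * i = 2 ^ (a - 1)] (mod 2 ^ a)"
      using a_ge_2 by (intro cong_half_modulus_cases) auto
    then have "e (2 * i) (2 * 1) = e 0 (2 * 1) \<or> e (2 * i) (2 * 1) = e (2 ^ (a - 1)) (2 * 1)"
      by (simp only: M.eq_iff) simp
    then show ?thesis using 2 unfolding normal_maximal_def by auto
  qed
next
  assume "H \<in> normal_maximal"
  then obtain i j where H: "H = M.C i j" and ij: "odd i \<or> odd j"
    and t: "\<exists>t. [r * i = t * i] (mod 2 ^ a) \<and> [j = t * j] (mod 2 ^ b)"
  proof -
    have half_b: "[2 ^ (b - 1) = r * 2 ^ (b - 1)] (mod 2 ^ b)"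
      using odd_mult_half_modulus[OF odd_r, of b] b_ge_2 by (simp add: cong_sym_eq)
    have half_a: "[r * 2 ^ (a - 1) = 1 * 2 ^ (a - 1)] (mod 2 ^ a)"
      using odd_mult_half_modulus[OF odd_r, of a] a_ge_2 by simp
    from \<open>H \<in> normal_maximal\<close> consider "H = M.C 1 0" | "H = M.C 1 (2 ^ (b - 1))" | "H = M.C 0 1"
      | "H = M.C (2 ^ (a - 1)) 1" unfolding normal_maximal_def by blast
    then show thesis
    proof cases
      case 1
      show thesis by (rule that[OF 1]) (auto intro: exI[of _ r])
    next
      case 2
      show thesis by (rule that[OF 2]) (use half_b in \<open>auto intro!: exI[of _ r]\<close>)
    next
      case 3
      show thesis by (rule that[OF 3]) (auto intro: exI[of _ 1])
    next
      case 4
      show thesis by (rule that[OF 4]) (use half_a in \<open>auto intro!: exI[of _ 1]\<close>)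
    qed
  qed
  have "odd (r * i) \<or> odd j" using ij odd_r by simp
  then have "M.C (r * i) j = M.C i j" using M.C_eqI_primitive t M.C_subset_iff by blast
  then have "conjugate G (e 0 1) H = H" using H conjugate_C[of 0 1 i j] by simp
  moreover have "maximal_cyclic_subgroup H M"
    unfolding M.maximal_iff_primitive by (intro exI conjI) (rule H, rule ij)
  ultimately show "maximal_cyclic_subgroup H M \<and> conjugate G (e 0 1) H = H" by simp
qed

text \<open>
  The numbers \<open>(1 + r) k\<close> are killed by 2 modulo \<open>2\<^sup>a\<close>, so each is congruent to 0 or to half the
  modulus, and both occur unless all of them vanish.
\<close>

lemma absorbed_eq:
  "absorbed = (if 2 ^ a dvd r + 1 then {M.C 0 1} else {M.C 0 1, M.C (2 ^ (a - 1)) 1})"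
proof -
  have C_cong: "M.C i 1 = M.C i' 1" if "[i = i'] (mod 2 ^ a)" for i i'
    using that M.eq_iff[of i 1 i' 1] by simp
  have cases_k: "[(1 + r) * k = 0] (mod 2 ^ a) \<or> [(1 + r) * k = 2 ^ (a - 1)] (mod 2 ^ a)" for k
  proof (rule cong_half_modulus_cases)
    show "2 ^ a dvd 2 * ((1 + r) * k)"
      using dvd_mult2[OF r_near_minus_1, of k] by (simp add: ac_simps)
  qed (use a_ge_2 in simp)
  have zero: "M.C 0 1 \<in> absorbed"
    unfolding absorbed_def by (rule range_eqI[of _ _ 0]) simp
  show ?thesis
  proof (cases "2 ^ a dvd r + 1")
    case True
    then have "[(1 + r) * k = 0] (mod 2 ^ a)" for k by (simp add: cong_0_iff add.commute)
    then have "absorbed \<subseteq> {M.C 0 1}" using C_cong unfolding absorbed_def by blast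
    then show ?thesis using True zero by auto
  next
    case False
    then have "[(1 + r) * 1 = 2 ^ (a - 1)] (mod 2 ^ a)"
      using cases_k[of 1] by (auto simp: cong_0_iff add.commute)
    then have "M.C (2 ^ (a - 1)) 1 \<in> absorbed"
      unfolding absorbed_def by (intro range_eqI[of _ _ 1]) (rule C_cong[symmetric])
    moreover have "absorbed \<subseteq> {M.C 0 1, M.C (2 ^ (a - 1)) 1}"
      using C_cong cases_k unfolding absorbed_def by blast
    ultimately show ?thesis using False zero by auto
  qed
qed

text \<open>
  The classes outside \<open>M\<close> contribute 2.  Inside \<open>M\<close>, the involution induced by \<open>y\<close> acts on the
  maximal cyclic subgroups that are not absorbed, and its orbits are counted by its fixed points.
\<close>

lemma twice_eta_eq: "2 * eta G + 2 * (if 2 ^ a dvd r + 1 then 1 else 2) = eta M + 8"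
proof -
  define S where "S = {H. maximal_cyclic_subgroup H M} - absorbed"
  define \<sigma> where "\<sigma> = conjugate G (e 0 1)"
  define orb where "orb H = (\<lambda>u. conjugate G u H) ` carrier G" for H
  let ?c = "if 2 ^ a dvd r + 1 then 1 else 2 :: nat"
  \<comment> \<open>Absorbed subgroups are fixed points, so removing them leaves 4 minus their number.\<close>
  have sub: "absorbed \<subseteq> normal_maximal" unfolding absorbed_eq normal_maximal_def by auto
  have fin_abs: "finite absorbed" and card_abs: "card absorbed = ?c"
    unfolding absorbed_eq using C_half_1_neq by auto
  have sub': "absorbed \<subseteq> {H. maximal_cyclic_subgroup H M}"
    using sub normal_maximal_iff by auto
  note fin = M.finite_card_maximal_cyclic_subgroups(1)
  have card_S: "card S = eta M - ?c"
    using card_Diff_subset[OF fin_abs sub'] card_abs M.finite_card_maximal_cyclic_subgroups(2) M.eta_eq_g2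
    by (simp add: S_def)
  have le: "?c \<le> eta M"
    using card_mono[OF fin sub'] card_abs M.finite_card_maximal_cyclic_subgroups(2) M.eta_eq_g2 by simp
  have "{H \<in> S. \<sigma> H = H} = normal_maximal - absorbed"
    using normal_maximal_iff by (auto simp: S_def \<sigma>_def)
  then have card_fixed: "card {H \<in> S. \<sigma> H = H} = 4 - ?c"
    using card_Diff_subset[OF fin_abs sub] card_abs card_normal_maximal by simp
  have \<sigma>_C: "\<sigma> (M.C i j) = M.C (r * i) j" for i j by (simp add: \<sigma>_def conjugate_C)
  have \<sigma>_\<sigma>: "\<sigma> (\<sigma> (M.C i j)) = M.C i j" for i j
  proof -
    have "[r * (r * i) = i] (mod 2 ^ a)"
      using cong_scalar_right[OF r_squared, of i] by (simp add: mult.assoc)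
    then have "e (r * (r * i)) (2 * j) = e i (2 * j)" by (simp add: eq_iff)
    then show ?thesis by (simp add: \<sigma>_C)
  qed
  have S_C: "\<exists>i j. H = M.C i j \<and> (odd i \<or> odd j)" if "H \<in> S" for H
    using that M.maximal_iff_primitive[of H] by (simp add: S_def)
  have \<sigma>_S: "\<sigma> H \<in> S" and \<sigma>_\<sigma>_S: "\<sigma> (\<sigma> H) = H" if "H \<in> S" for H
  proof -
    obtain i j where H: "H = M.C i j" "odd i \<or> odd j" using S_C \<open>H \<in> S\<close> by blast
    show inv: "\<sigma> (\<sigma> H) = H" using H(1) \<sigma>_\<sigma> by simp
    have "odd (r * i) \<or> odd j" using H(2) odd_r by simp
    then have "maximal_cyclic_subgroup (\<sigma> H) M"
      unfolding M.maximal_iff_primitive H(1) \<sigma>_C by blast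
    moreover have "\<sigma> H \<notin> absorbed"
    proof
      assume "\<sigma> H \<in> absorbed"
      then have "\<sigma> (\<sigma> H) = \<sigma> H" using sub normal_maximal_iff unfolding \<sigma>_def by blast
      then show False using inv \<open>\<sigma> H \<in> absorbed\<close> \<open>H \<in> S\<close> by (simp add: S_def)
    qed
    ultimately show "\<sigma> H \<in> S" by (simp add: S_def)
  qed
  have finS: "finite S" using fin by (simp add: S_def)
  have orb_S: "orb H = {H, \<sigma> H}" if "H \<in> S" for H
    using S_C[OF that] conjugates_of_C by (auto simp: orb_def \<sigma>_def)
  then have "orb ` S = (\<lambda>H. {H, \<sigma> H}) ` S" by (rule image_cong[OF HOL.refl])
  then have card_orb_S: "2 * card (orb ` S) = (eta M - ?c) + (4 - ?c)"
    using card_involution_orbits[of S \<sigma>, OF finS \<sigma>_S \<sigma>_\<sigma>_S] card_S card_fixed by simp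
  have orb_D: "orb (D i) = D ` {i'. even i' \<longleftrightarrow> even i}" for i
    unfolding orb_def by (rule conjugates_of_D)
  have "orb ` range D = {D ` {i. even i}, D ` {i. odd i}}"
  proof (intro equalityI subsetI)
    fix K assume "K \<in> orb ` range D"
    then show "K \<in> {D ` {i. even i}, D ` {i. odd i}}" unfolding image_image orb_D by auto
  next
    fix K assume "K \<in> {D ` {i. even i}, D ` {i. odd i}}"
    then have "K = orb (D 0) \<or> K = orb (D 1)" unfolding orb_D by auto
    then show "K \<in> orb ` range D" by blast
  qed
  moreover have "D ` {i. even i} \<noteq> D ` {i. odd i}"
  proof
    assume "D ` {i. even i} = D ` {i. odd i}"
    moreover have "D 0 \<in> D ` {i. even i}" by simp
    ultimately have "D 0 \<in> D ` {i. odd i}" by simp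
    then obtain i where "D 0 = D i" "odd i" by (rule imageE) simp
    then show False using D_eq_imp_same_parity[of 0 i] by simp
  qed
  ultimately have card_orb_D: "card (orb ` range D) = 2" "finite (orb ` range D)" by simp_all
  have "orb ` range D \<inter> orb ` S = {}"
  proof -
    have False if H: "H \<in> S" and eq: "orb (D i) = orb H" for H i
    proof -
      have "D i \<in> orb (D i)" unfolding orb_D by simp
      then have "D i \<in> {H, \<sigma> H}" unfolding eq orb_S[OF H] .
      then have "D i \<in> S" using H \<sigma>_S[OF H] by (elim insertE) simp_all
      then obtain k l where "D i = M.C k l" using S_C by blast
      then show False using D_not_subset_M[of i] M.powers_subset_carrier[OF M.m_closed] by simp
    qed
    then show ?thesis by auto
  qed
  then have "card (orb ` range D \<union> orb ` S) = 2 + card (orb ` S)"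
    using card_Un_disjoint[of "orb ` range D" "orb ` S"] finS card_orb_D by simp
  moreover have "eta G = card (orb ` range D \<union> orb ` S)"
    unfolding eta_eq orb_def[symmetric] maximal_cyclic_subgroups_G S_def image_Un ..
  ultimately show ?thesis using card_orb_S le by (auto split: if_splits)
qed

end

section \<open>Coordinates in the presented group\<close>

lemma (in group) int_pow_cong:
  assumes "x \<in> carrier G" "x [^] (2 ^ n :: nat) = \<one>" "[i = k] (mod 2 ^ n)"
  shows "x [^] i = x [^] (k::int)"
proof -
  obtain t where t: "k = i + 2 ^ n * t" using assms(3) by (auto simp: cong_iff_lin)
  have "x [^] (2 ^ n :: int) = \<one>" using assms(2) int_pow_int[of G x "2 ^ n"] by simp
  then have "x [^] (2 ^ n * t) = \<one>" using assms(1) by (simp flip: int_pow_pow)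
  then show ?thesis using assms(1) t by (simp add: int_pow_mult)
qed

text \<open>
  Since \<open>r\<^sup>2\<close> is 1 modulo \<open>2\<^sup>a\<close>, moving \<open>y\<close> past \<open>x\<^sup>k\<close> in either direction turns \<open>k\<close> into \<open>r k\<close>.
\<close>

lemma (in group) metacyclic_mult:
  fixes r :: int
  assumes x: "x \<in> carrier G" and y: "y \<in> carrier G"
    and xp: "x [^] (2 ^ a :: nat) = \<one>" and yp: "y [^] (2 ^ Suc b :: nat) = \<one>"
    and conj: "inv y \<otimes> x \<otimes> y = x [^] r" and r2: "[r * r = 1] (mod 2 ^ a)"
  shows "(x [^] i \<otimes> y [^] j) \<otimes> (x [^] k \<otimes> y [^] l) =
    x [^] (i + (if even j then k else r * k)) \<otimes> y [^] (j + l :: int)"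
proof -
  have xy: "x [^] k \<otimes> y = y \<otimes> x [^] (r * k)" for k
  proof -
    have "inv y \<otimes> x [^] k \<otimes> y = x [^] (r * k)"
      using conjugation_pow[OF inv_closed[OF y] x, of k] x y by (simp add: conj int_pow_pow)
    then show ?thesis using x y by (metis inv_closed inv_solve_left int_pow_closed m_assoc m_closed)
  qed
  have r2': "x [^] (r * (r * k)) = x [^] k" for k
    using int_pow_cong[OF x xp cong_scalar_right[OF r2, of k]] by (simp add: mult.assoc)
  have yx: "y \<otimes> x [^] k = x [^] (r * k) \<otimes> y" for k
    using xy[of "r * k"] r2' by simp
  have yx_nat: "y [^] n \<otimes> x [^] k = x [^] (if even n then k else r * k) \<otimes> y [^] n" for n :: nat and k
  proof (induction n arbitrary: k)
    case 0
    then show ?case using x by simp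
  next
    case (Suc n)
    have "y [^] Suc n \<otimes> x [^] k = y [^] n \<otimes> x [^] (r * k) \<otimes> y"
      using x y by (simp add: m_assoc yx)
    also have "\<dots> = x [^] (if even n then r * k else r * (r * k)) \<otimes> y [^] Suc n"
      using x y by (simp add: Suc m_assoc)
    finally show ?case by (simp add: r2')
  qed
  \<comment> \<open>Reducing the exponent to a natural number modulo \<open>2\<^bsup>b + 1\<^esup>\<close> keeps its parity.\<close>
  have y_nat: "y [^] j = y [^] nat (j mod 2 ^ Suc b)"
  proof -
    have "y [^] j = y [^] (j mod 2 ^ Suc b)" by (rule int_pow_cong[OF y yp]) (simp add: cong_def)
    then show ?thesis using int_pow_int[of G y "nat (j mod 2 ^ Suc b)"] by simp
  qed
  have "even (nat (j mod 2 ^ Suc b)) \<longleftrightarrow> even j" by (simp add: even_nat_iff dvd_mod_iff)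
  then have "y [^] j \<otimes> x [^] k = x [^] (if even j then k else r * k) \<otimes> y [^] j"
    using yx_nat[of "nat (j mod 2 ^ Suc b)" k] unfolding y_nat[symmetric] by simp
  then have "x [^] i \<otimes> (y [^] j \<otimes> x [^] k) \<otimes> y [^] l =
      x [^] i \<otimes> (x [^] (if even j then k else r * k) \<otimes> y [^] j) \<otimes> y [^] l" by simp
  then show ?thesis using x y by (simp add: int_pow_mult m_assoc)
qed

text \<open>
  Right multiplication of \<open>x\<^sup>i y\<^sup>j\<close> by a letter, in the coordinates \<open>(i, j)\<close>.
\<close>

fun letter_action :: "int \<Rightarrow> metacyclic_gen \<times> bool \<Rightarrow> int \<times> int \<Rightarrow> int \<times> int" where
  "letter_action r (Gen_x, inverted) (i, j) =
     (i + (if inverted then - 1 else 1) * (if even j then 1 else r), j)"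
| "letter_action r (Gen_y, inverted) (i, j) = (i, j + (if inverted then - 1 else 1))"

definition word_action :: "int \<Rightarrow> metacyclic_gen word \<Rightarrow> int \<times> int \<Rightarrow> int \<times> int" where
  "word_action r w = fold (letter_action r) w"

definition cong_pair :: "nat \<Rightarrow> nat \<Rightarrow> int \<times> int \<Rightarrow> int \<times> int \<Rightarrow> bool" where
  "cong_pair a b p q \<longleftrightarrow> [fst p = fst q] (mod 2 ^ a) \<and> [snd p = snd q] (mod 2 ^ b)"

lemma letter_action_cong:
  assumes "cong_pair a (Suc b) p q"
  shows "cong_pair a (Suc b) (letter_action r c p) (letter_action r c q)"
proof -
  obtain i j k l where pq: "p = (i, j)" "q = (k, l)" by (cases p, cases q) auto
  obtain g inverted where c: "c = (g, inverted)" by (cases c)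
  have "[i = k] (mod 2 ^ a)" "[j = l] (mod 2 ^ Suc b)" using assms by (simp_all add: cong_pair_def pq)
  moreover from this(2) have "even j \<longleftrightarrow> even l" using odd_if_cong_odd by blast
  ultimately show ?thesis by (cases g) (simp_all add: cong_pair_def pq c cong_add)
qed

lemma word_action_cong:
  "cong_pair a (Suc b) p q \<Longrightarrow> cong_pair a (Suc b) (word_action r w p) (word_action r w q)"
proof (induction w arbitrary: p q)
  case (Cons c w)
  then show ?case using letter_action_cong by (simp add: word_action_def)
qed (simp add: word_action_def)

lemma word_action_append: "word_action r (u @ v) p = word_action r v (word_action r u p)"
  by (simp add: word_action_def)

lemma word_action_pow_x:
  "word_action r (word_pow letter_x n) (i, j) = (i + int n * (if even j then 1 else r), j)"
  by (induction n arbitrary: i) (simp_all add: word_action_def word_pow_def algebra_simps)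

lemma word_action_pow_y: "word_action r (word_pow letter_y n) (i, j) = (i, j + int n)"
  by (induction n arbitrary: j) (simp_all add: word_action_def word_pow_def)

text \<open>
  The two sides of each relation act alike modulo \<open>2\<^sup>a\<close> and \<open>2\<^bsup>b + 1\<^esup>\<close>.  The conjugation relation at odd \<open>j\<close> uses
  \<open>r\<^sup>2 = 1\<close>; the second modulus being even, the parity of \<open>j\<close> in the action is well defined.
\<close>

lemma word_eq_imp_cong_action:
  assumes "word_eq (G2_neg_relations a (Suc b) 0 \<delta>) u v"
    and r: "r = 2 ^ (a - \<delta>) - 1" and r2: "[r * r = 1] (mod 2 ^ a)"
  shows "cong_pair a (Suc b) (word_action r u p) (word_action r v p)"
  using assms(1)
proof (induction arbitrary: p rule: word_eq.induct)
  case (refl u)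
  then show ?case by (simp add: cong_pair_def)
next
  case (sym u v)
  then show ?case by (simp add: cong_pair_def cong_sym_eq)
next
  case (trans u v w)
  then show ?case unfolding cong_pair_def by (meson cong_trans)
next
  case (append u u' v v')
  have "cong_pair a (Suc b) (word_action r v (word_action r u p)) (word_action r v (word_action r u' p))"
    using append.IH(1) by (rule word_action_cong)
  moreover have "cong_pair a (Suc b) (word_action r v (word_action r u' p)) (word_action r v' (word_action r u' p))"
    by (rule append.IH(2))
  ultimately show ?case unfolding word_action_append cong_pair_def by (meson cong_trans)
next
  case (cancel g inverted)
  obtain i j where "p = (i, j)" by (cases p)
  then show ?case by (cases g; cases inverted) (simp_all add: word_action_def cong_pair_def)
next
  case (relation u v)
  obtain i j where p: "p = (i, j)" by (cases p)
  have r_nat: "int (2 ^ (a - \<delta>) - 1) = r" by (simp add: r of_nat_diff)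
  from relation consider "u = word_pow letter_x (2 ^ a)" "v = []"
    | "u = word_pow letter_y (2 ^ Suc b)" "v = word_pow letter_x (2 ^ a)"
    | "u = letter_y_inv @ letter_x @ letter_y" "v = word_pow letter_x (2 ^ (a - \<delta>) - 1)"
    unfolding G2_neg_relations_def by auto
  then show ?case
  proof cases
    case 1
    then show ?thesis
      by (simp add: p word_action_pow_x cong_pair_def cong_iff_dvd_diff) (simp add: word_action_def)
  next
    case 2
    then show ?thesis
      by (simp add: p word_action_pow_x word_action_pow_y cong_pair_def cong_iff_dvd_diff)
  next
    case 3
    then show ?thesis
      using r2 unfolding 3(2) p word_action_pow_x r_nat
      by (simp add: 3(1) p word_action_def cong_pair_def cong_add_lcancel cong_sym_eq)
  qed
qed

lemma one_presented_group: "\<one>\<^bsub>presented_group R\<^esub> = word_class R []"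
  by (simp add: presented_group_def)

lemma word_class_pow:
  "word_class R (word_pow u n) = word_class R u [^]\<^bsub>presented_group R\<^esub> n"
proof -
  interpret group "presented_group R" by (rule group_presented_group)
  show ?thesis
  proof (induction n)
    case 0
    show ?case by (simp add: word_pow_def one_presented_group)
  next
    case (Suc n)
    have "word_pow u (Suc n) = word_pow u n @ u"
      by (simp add: word_pow_def replicate_append_same[symmetric] del: replicate_append_same)
    then show ?case using Suc by (simp add: presented_group_mult[symmetric])
  qed
qed

lemma word_class_carrier: "word_class R u \<in> carrier (presented_group R)"
  by (simp add: presented_group_def)

lemma word_class_inverse_letter:
  "word_class R [(g, True)] = inv\<^bsub>presented_group R\<^esub> word_class R [(g, False)]"
proof -
  interpret group "presented_group R" by (rule group_presented_group)
  have "word_class R [(g, True)] \<otimes>\<^bsub>presented_group R\<^esub> word_class R [(g, False)] = \<one>\<^bsub>presented_group R\<^esub>"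
    using word_eq.cancel[of R g True]
    by (simp add: presented_group_mult word_class_eq_iff one_presented_group)
  then show ?thesis by (metis inv_equality word_class_carrier)
qed

lemma presented_group_induct [consumes 1, case_names one gen inv_gen]:
  assumes "A \<in> carrier (presented_group R)"
    and "P \<one>\<^bsub>presented_group R\<^esub>"
    and "\<And>A g. P A \<Longrightarrow> A \<in> carrier (presented_group R) \<Longrightarrow> P (A \<otimes>\<^bsub>presented_group R\<^esub> presented_gen R g)"
    and "\<And>A g. P A \<Longrightarrow> A \<in> carrier (presented_group R) \<Longrightarrow>
      P (A \<otimes>\<^bsub>presented_group R\<^esub> inv\<^bsub>presented_group R\<^esub> presented_gen R g)"
  shows "P A"
proof -
  obtain w where A: "A = word_class R w" using assms(1) by (auto simp: presented_group_def)
  have "P (word_class R w)"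
  proof (induction w rule: rev_induct)
    case Nil
    then show ?case using assms(2) by (simp add: one_presented_group)
  next
    case (snoc c w)
    obtain g inverted where c: "c = (g, inverted)" by (cases c)
    have "word_class R (w @ [c]) = word_class R w \<otimes>\<^bsub>presented_group R\<^esub>
        (if inverted then inv\<^bsub>presented_group R\<^esub> presented_gen R g else presented_gen R g)"
      by (simp add: c presented_gen_def word_class_inverse_letter[symmetric] presented_group_mult)
    then show ?case
      using assms(3,4)[OF snoc word_class_carrier] by simp
  qed
  then show ?thesis using A by simp
qed

text \<open>
  The relations give the multiplication rule and hence that every element has coordinates; that
  the coordinates are unique follows by letting equal words act on the pair \<open>(0, 0)\<close>.
\<close>

lemma G2_neg_is_negative_metacyclic:
  fixes a b \<delta> :: nat
  defines "G \<equiv> G2_neg a (Suc b) 0 \<delta>"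
    and "x \<equiv> G2_neg_x a (Suc b) 0 \<delta>" and "y \<equiv> G2_neg_y a (Suc b) 0 \<delta>"
    and "r \<equiv> 2 ^ (a - \<delta>) - 1 :: int"
  assumes \<delta>: "\<delta> \<le> 1" "\<delta> + 2 \<le> a" and b: "b \<ge> 2"
  shows "negative_metacyclic_2_group G (\<lambda>i j. x [^]\<^bsub>G\<^esub> i \<otimes>\<^bsub>G\<^esub> y [^]\<^bsub>G\<^esub> j) r a b"
proof -
  define R where "R = G2_neg_relations a (Suc b) 0 \<delta>"
  have G: "G = presented_group R" and x_eq: "x = word_class R letter_x" and y_eq: "y = word_class R letter_y"
    by (simp_all add: G_def x_def y_def G2_neg_def G2_neg_x_def G2_neg_y_def presented_gen_def R_def)
  interpret group G unfolding G by (rule group_presented_group)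
  have x: "x \<in> carrier G" and y: "y \<in> carrier G" by (simp_all add: G x_eq y_eq word_class_carrier)
  have "(2::int) ^ 2 dvd 2 ^ (a - \<delta>)" using \<delta>(2) by (intro le_imp_power_dvd) simp
  then have r4: "4 dvd r + 1" by (simp add: r_def)
  have "(2::int) ^ a dvd 2 ^ Suc (a - \<delta>)" using \<delta>(1) by (intro le_imp_power_dvd) simp
  then have r_near: "2 ^ a dvd 2 * (r + 1)" by (simp add: r_def)
  have "r * r - 1 = 2 * (r + 1) * ((r - 1) div 2)"
  proof -
    have "odd r" using r4 by presburger
    then obtain q where "r = 2 * q + 1" by (rule oddE)
    then show ?thesis by (simp add: algebra_simps)
  qed
  then have r2: "[r * r = 1] (mod 2 ^ a)" using r_near by (simp add: cong_iff_dvd_diff)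
  have xp: "x [^]\<^bsub>G\<^esub> (2 ^ a :: nat) = \<one>\<^bsub>G\<^esub>"
  proof -
    have "word_eq R (word_pow letter_x (2 ^ a)) []"
      by (rule word_eq.relation) (simp add: R_def G2_neg_relations_def)
    then show ?thesis by (simp add: one_presented_group x_eq G word_class_pow[symmetric] word_class_eq_iff)
  qed
  have yp: "y [^]\<^bsub>G\<^esub> (2 ^ Suc b :: nat) = \<one>\<^bsub>G\<^esub>"
  proof -
    have "word_eq R (word_pow letter_y (2 ^ Suc b)) (word_pow letter_x (2 ^ a))"
      by (rule word_eq.relation) (simp add: R_def G2_neg_relations_def)
    then have "y [^]\<^bsub>G\<^esub> (2 ^ Suc b :: nat) = x [^]\<^bsub>G\<^esub> (2 ^ a :: nat)"
      by (simp only: x_eq y_eq G word_class_pow[symmetric] word_class_eq_iff)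
    then show ?thesis using xp by simp
  qed
  have conj: "inv\<^bsub>G\<^esub> y \<otimes>\<^bsub>G\<^esub> x \<otimes>\<^bsub>G\<^esub> y = x [^]\<^bsub>G\<^esub> r"
  proof -
    have "word_eq R (letter_y_inv @ letter_x @ letter_y) (word_pow letter_x (2 ^ (a - \<delta>) - 1))"
      by (rule word_eq.relation) (simp add: R_def G2_neg_relations_def)
    then have "inv\<^bsub>G\<^esub> y \<otimes>\<^bsub>G\<^esub> x \<otimes>\<^bsub>G\<^esub> y = x [^]\<^bsub>G\<^esub> (2 ^ (a - \<delta>) - 1 :: nat)"
      by (simp add: x_eq y_eq G word_class_pow[symmetric] word_class_eq_iff presented_group_mult
          word_class_inverse_letter[symmetric])
    moreover have "int (2 ^ (a - \<delta>) - 1) = r" by (simp add: r_def of_nat_diff)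
    ultimately show ?thesis using int_pow_int[of G x "2 ^ (a - \<delta>) - 1"] by simp
  qed
  define e where "e i j = x [^]\<^bsub>G\<^esub> (i::int) \<otimes>\<^bsub>G\<^esub> y [^]\<^bsub>G\<^esub> (j::int)" for i j
  have mult: "e i j \<otimes>\<^bsub>G\<^esub> e k l = e (i + (if even j then k else r * k)) (j + l)" for i j k l
    unfolding e_def by (rule metacyclic_mult[OF x y xp yp conj r2])
  have gens: "x = e 1 0" "y = e 0 1" "inv\<^bsub>G\<^esub> x = e (- 1) 0" "inv\<^bsub>G\<^esub> y = e 0 (- 1)"
    using x y by (simp_all add: e_def int_pow_neg)
  have carrier: "carrier G = (\<Union>i. range (e i))"
  proof (intro equalityI subsetI)
    fix A assume "A \<in> carrier G"
    then have "A \<in> carrier (presented_group R)" by (simp add: G)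
    then show "A \<in> (\<Union>i. range (e i))"
    proof (induction rule: presented_group_induct)
      case one
      have "\<one>\<^bsub>G\<^esub> = e 0 0" by (simp add: e_def)
      then show ?case unfolding G[symmetric] by blast
    next
      case (gen A g)
      have "presented_gen R g = x \<or> presented_gen R g = y"
        by (cases g) (simp_all add: presented_gen_def x_eq y_eq)
      then obtain k l where "presented_gen R g = e k l" using gens by blast
      moreover obtain i j where "A = e i j" using gen by blast
      ultimately show ?case unfolding G[symmetric] by (auto simp: mult)
    next
      case (inv_gen A g)
      have "presented_gen R g = x \<or> presented_gen R g = y"
        by (cases g) (simp_all add: presented_gen_def x_eq y_eq)
      then obtain k l where "inv\<^bsub>G\<^esub> presented_gen R g = e k l" using gens by metis
      moreover obtain i j where "A = e i j" using inv_gen by blast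
      ultimately show ?case unfolding G[symmetric] by (auto simp: mult)
    qed
  next
    fix A assume "A \<in> (\<Union>i. range (e i))"
    then show "A \<in> carrier G" using x y by (auto simp: e_def)
  qed
  have eq: "e i j = e k l \<longleftrightarrow> [i = k] (mod 2 ^ a) \<and> [j = l] (mod 2 ^ Suc b)" for i j k l
  proof
    assume "[i = k] (mod 2 ^ a) \<and> [j = l] (mod 2 ^ Suc b)"
    then show "e i j = e k l"
      unfolding e_def using int_pow_cong[OF x xp] int_pow_cong[OF y yp] by metis
  next
    \<comment> \<open>A word for \<open>e i j\<close> needs natural exponents, hence the residues.\<close>
  define w where "w i j = word_pow letter_x (nat (i mod 2 ^ a)) @ word_pow letter_y (nat (j mod 2 ^ Suc b))" for i j :: int
    have e_w: "e i j = word_class R (w i j)" for i j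
    proof -
      have "e i j = x [^]\<^bsub>G\<^esub> (i mod 2 ^ a) \<otimes>\<^bsub>G\<^esub> y [^]\<^bsub>G\<^esub> (j mod 2 ^ Suc b)"
        unfolding e_def using int_pow_cong[OF x xp, of i "i mod 2 ^ a"] int_pow_cong[OF y yp, of j "j mod 2 ^ Suc b"]
        by (simp add: cong_def)
      also have "\<dots> = x [^]\<^bsub>G\<^esub> nat (i mod 2 ^ a) \<otimes>\<^bsub>G\<^esub> y [^]\<^bsub>G\<^esub> nat (j mod 2 ^ Suc b)"
        using int_pow_int[of G x "nat (i mod 2 ^ a)"] int_pow_int[of G y "nat (j mod 2 ^ Suc b)"] by simp
      also have "\<dots> = word_class R (w i j)"
        by (simp add: G x_eq y_eq word_class_pow[symmetric] presented_group_mult w_def)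
      finally show ?thesis .
    qed
    have act: "word_action r (w i j) (0, 0) = (i mod 2 ^ a, j mod 2 ^ Suc b)" for i j
      by (simp add: w_def word_action_append word_action_pow_x word_action_pow_y)
    assume "e i j = e k l"
    then have "word_eq (G2_neg_relations a (Suc b) 0 \<delta>) (w i j) (w k l)"
      by (simp add: e_w word_class_eq_iff R_def)
    from word_eq_imp_cong_action[OF this r_def[THEN meta_eq_to_obj_eq] r2, of "(0, 0)"]
    show "[i = k] (mod 2 ^ a) \<and> [j = l] (mod 2 ^ Suc b)"
      by (simp add: act cong_pair_def cong_def)
  qed
  have "negative_metacyclic_2_group G e r a b"
    by unfold_locales (use carrier mult eq r4 r_near \<delta>(2) b in auto)
  then show ?thesis unfolding e_def .
qed

theorem theorem4p4:
  fixes \<alpha> \<beta> \<delta> :: nat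
    and G M :: "metacyclic_gen word set monoid"
    and x y :: "metacyclic_gen word set"
  assumes params: "G2_neg_params \<alpha> \<beta> 0 \<delta>"
    and beta: "\<beta> \<ge> 3"
    and G: "G = G2_neg \<alpha> \<beta> 0 \<delta>"
    and x: "x = G2_neg_x \<alpha> \<beta> 0 \<delta>"
    and y: "y = G2_neg_y \<alpha> \<beta> 0 \<delta>"
    and M: "M = subgroup_generated G {x, y [^]\<^bsub>G\<^esub> (2::nat)}"
  shows "(\<delta> = 1 \<longrightarrow>
            real (eta G) = real (eta M) / 2 + 2 \<and>
            real (eta M) / 2 + 2 = real (g2 \<alpha> (\<beta> - 1)) / 2 + 2) \<and>
         (\<delta> = 0 \<longrightarrow>
            real (eta G) = real (eta M) / 2 + 3 \<and>
            real (eta M) / 2 + 3 = real (g2 \<alpha> (\<beta> - 1)) / 2 + 3)"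
proof -
  have main: "eta M = g2 \<alpha> (\<beta> - 1) \<and> 2 * eta G + 2 * (if \<delta> = 0 then 1 else 2) = eta M + 8"
    if \<delta>: "\<delta> \<le> 1"
  proof -
    obtain b where b: "\<beta> = Suc b" "b \<ge> 2" using beta by (cases \<beta>) auto
    have \<alpha>: "\<delta> + 2 \<le> \<alpha>" using params by (simp add: G2_neg_params_def)
    define r :: int where "r = 2 ^ (\<alpha> - \<delta>) - 1"
    define e where "e i j = x [^]\<^bsub>G\<^esub> (i::int) \<otimes>\<^bsub>G\<^esub> y [^]\<^bsub>G\<^esub> (j::int)" for i j
    interpret N: negative_metacyclic_2_group G e r \<alpha> b
      using G2_neg_is_negative_metacyclic[OF \<delta> \<alpha> b(2)]
      by (simp add: G x y b(1) r_def e_def[abs_def])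
    have "x \<in> carrier G" "y \<in> carrier G"
      by (simp_all add: G x y G2_neg_def G2_neg_x_def G2_neg_y_def presented_gen_def word_class_carrier)
    then have "x = e 1 0" "y [^]\<^bsub>G\<^esub> (2::nat) = e 0 2"
      using int_pow_int[of G y 2] by (simp_all add: e_def)
    then have M_eq: "M = N.M" by (simp add: M N.M_def)
    have "2 ^ \<alpha> dvd r + 1 \<longleftrightarrow> \<delta> = 0"
    proof -
      have "2 ^ \<alpha> dvd r + 1 \<longleftrightarrow> \<alpha> \<le> \<alpha> - \<delta>" by (simp add: r_def dvd_power_iff)
      then show ?thesis using \<alpha> by auto
    qed
    then show ?thesis using N.twice_eta_eq N.M.eta_eq_g2 M_eq b(1) by simp
  qed
  show ?thesis
  proof (intro conjI impI)
    assume "\<delta> = 1"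
    then have "eta M = g2 \<alpha> (\<beta> - 1)" "2 * eta G + 4 = eta M + 8" using main by simp_all
    then show "real (eta G) = real (eta M) / 2 + 2"
      "real (eta M) / 2 + 2 = real (g2 \<alpha> (\<beta> - 1)) / 2 + 2" by linarith+
  next
    assume "\<delta> = 0"
    then have "eta M = g2 \<alpha> (\<beta> - 1)" "2 * eta G + 2 = eta M + 8" using main by simp_all
    then show "real (eta G) = real (eta M) / 2 + 3"
      "real (eta M) / 2 + 3 = real (g2 \<alpha> (\<beta> - 1)) / 2 + 3" by linarith+
  qed
qed

end
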